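(* Let $\nu>0$. If $p_\gamma=0$ (piecewise constant polynomials in time), then the linear system for the viscous terms $$\Big(\overline{M}_i-\nu\sum_{j\in S_i}\mathcal{D}_{i,j}\overline{M}_j^{-1}\mathcal{Q}_{i,j}\Big)\bar v_i-\nu\sum_{j\in S_i}\mathcal{D}_{i,j}\overline{M}_j^{-1}\mathcal{Q}_{\wp(i,j),j}\,\bar v_{\wp(i,j)}=b_i,\qquad i=1,\dots,N_e,$$ in which the unknowns, for each velocity component, are the coefficient vectors $\bar v_i\in\mathbb{R}^{N_\phi}$, $i=1,\dots,N_e$, and the $b_i$ are known right-hand sides, is positive definite, i.e. its coefficient matrix $\mathcal{S}\in\mathbb{R}^{N_eN_\phi\times N_eN_\phi}$ satisfies $x^\top\mathcal{S}x>0$ for every nonzero $x\in\mathbb{R}^{N_eN_\phi}$. Mesh, basis functions and the matrices $\overline{M}_i,\overline{M}_j,\mathcal{D}_{i,j},\mathcal{Q}_{i,j}$ are defined in the context.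
   Context: The system comes from a staggered space-time discontinuous Galerkin discretization of the 3D incompressible Navier-Stokes equations; $\nu$ is the (constant) kinematic viscosity coefficient, and $b_i$ collects known data (the velocity of the previous time step and the convective terms evaluated at the previous Picard iterate). Mesh. $\Omega\subset\mathbb{R}^3$ is covered by non-overlapping, possibly curved, tetrahedral elements $T_1,\dots,T_{N_e}$. The reference tetrahedron is $T_{ref}=\{(\xi,\eta,\zeta)\in\mathbb{R}^3:\xi,\eta,\zeta\ge0,\ \xi+\eta+\zeta\le1\}$, and $F_i:T_i\to T_{ref}$ is the invertible map from physical to reference coordinates. The faces are $\Gamma_1,\dots,\Gamma_{N_d}$, and $S_i$ is the set of the four indices $j$ such that $\Gamma_j$ is a face of $T_i$. The system is written with a neighbour across each face: for every $i$ and $j\in S_i$, $\wp(i,j)$ is the index of the neighbouring tetrahedron sharing $\Gamma_j$ with $T_i$. Of the two tetrahedra sharing $\Gamma_j$ one is arbitrarily called left, $T_{\ell(j)}$, and the other right, $T_{r(j)}$; $\vec n_j$ is the unit normal on $\Gamma_j$ pointing from left to right. The dual element $H_j$ associated with $\Gamma_j$ is the five-point hexahedron determined by the barycenters of $T_{\ell(j)}$ and $T_{r(j)}$ and the three vertices of $\Gamma_j$; $T_{i,j}=H_j\cap T_i$ for $j\in S_i$, so that $H_j=T_{\ell(j),j}\cup T_{r(j),j}$. For $j\in S_i$, $\vec n_{ij}$ is the unit normal on $\Gamma_j$ pointing outward from $T_i$, and $\sigma_{i,j}=\frac{r(j)-2i+\ell(j)}{r(j)-\ell(j)}$, i.e.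 $\sigma_{i,j}=1$ if $i=\ell(j)$ and $\sigma_{i,j}=-1$ if $i=r(j)$. Time. One time step is the interval $[t^n,t^{n+1}]$, $\Delta t=t^{n+1}-t^n>0$. The superscript $st$ denotes the Cartesian product with $[t^n,t^{n+1}]$ (for $T_i$, $T_{i,j}$, $H_j$, $\Gamma_j$). Basis functions. $p$ is the polynomial degree in space and $p_\gamma$ that in time; $N_\phi=N_\psi=(p+1)(p+2)(p+3)/6$. On $T_{ref}$, $\{\phi_k\}_{k=1}^{N_\phi}$ is the Lagrange nodal basis of the polynomials of total degree $\le p$ for the nodes $(j_1/p,j_2/p,j_3/p)$, $j_1,j_2,j_3\ge0$, $j_1+j_2+j_3\le p$; on $T_i$, $\phi_k^{(i)}=\phi_k\circ F_i$. On $H_j$, $\{\psi_k^{(j)}\}_{k=1}^{N_\psi}$ are the scaled monomials $(x-x_0)^{k_1}(y-y_0)^{k_2}(z-z_0)^{k_3}/h_j^{k_1+k_2+k_3}$, $k_1,k_2,k_3\ge0$, $k_1+k_2+k_3\le p$, with $(x_0,y_0,z_0)$ the center of $H_j$ and $h_j>0$ a characteristic length of $H_j$. The time basis consists of the $p_\gamma+1$ Lagrange polynomials through the Gauss-Legendre points of $[0,1]$, transported to $[t^n,t^{n+1}]$ by $t=t^n+\tau\Delta t$. The space-time basis functions $\tilde\phi_k^{(i)}$, $\tilde\psi_k^{(j)}$ are the products of space and time basis functions. For $p_\gamma=0$ the only time basis function is the constant $1$, so $\tilde\phi_k^{(i)}=\phi_k^{(i)}$ and $\tilde\psi_k^{(j)}=\psi_k^{(j)}$.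 Matrices (entry $(k,l)$; $\nabla$ is the spatial gradient; index $i$ refers to main-grid elements, $j$ to dual elements): $$(\overline{M}_i)_{kl}=\int_{T_i}\tilde\phi_k^{(i)}(\mathbf{x},t^{n+1})\tilde\phi_l^{(i)}(\mathbf{x},t^{n+1})\,d\mathbf{x}-\int_{T_i^{st}}\frac{\partial\tilde\phi_k^{(i)}}{\partial t}\tilde\phi_l^{(i)}\,d\mathbf{x}\,dt,\qquad(\overline{M}_j)_{kl}=\int_{H_j^{st}}\tilde\psi_k^{(j)}\tilde\psi_l^{(j)}\,d\mathbf{x}\,dt,$$ and, with entries in $\mathbb{R}^3$, $$(\mathcal{D}_{i,j})_{kl}=\int_{\Gamma_j^{st}}\tilde\phi_k^{(i)}\tilde\psi_l^{(j)}\vec n_{ij}\,dS\,dt-\int_{T_{i,j}^{st}}\nabla\tilde\phi_k^{(i)}\,\tilde\psi_l^{(j)}\,d\mathbf{x}\,dt,$$ $$(\mathcal{Q}_{i,j})_{kl}=\int_{T_{i,j}^{st}}\tilde\psi_k^{(j)}\nabla\tilde\phi_l^{(i)}\,d\mathbf{x}\,dt-\int_{\Gamma_j^{st}}\tilde\psi_k^{(j)}\tilde\phi_l^{(i)}\,\sigma_{i,j}\vec n_j\,dS\,dt.$$ On $\Gamma_j$, $\tilde\phi^{(i)}$ denotes the trace from $T_i$. In products, $\mathbb{R}^3$-valued entries are multiplied by the Euclidean inner product: $(\mathcal{D}_{i,j}\overline{M}_j^{-1}\mathcal{Q}_{i',j})_{kl}=\sum_{a,b}(\overline{M}_j^{-1})_{ab}\,(\mathcal{D}_{i,j})_{ka}\cdot(\mathcal{Q}_{i',j})_{bl}$.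 *)

theory Defs
  imports "HOL-Analysis.Analysis" "Jordan_Normal_Form.Gauss_Jordan_Elimination"
begin

no_notation Matrix.vec_index (infixl "$" 100)
no_notation Matrix.scalar_prod (infix "\<bullet>" 70)
unbundle no cross3_syntax


section \<open>Reference tetrahedron and mesh\<close>

definition ref_tet :: "(real^3) set" where
  "ref_tet = {x. 0 \<le> x$1 \<and> 0 \<le> x$2 \<and> 0 \<le> x$3 \<and> x$1 + x$2 + x$3 \<le> 1}"

definition ref_vertices :: "(real^3) set" where
  "ref_vertices = {0, axis 1 1, axis 2 1, axis 3 1}"

definition ref_faces :: "(real^3) set set" where
  "ref_faces = (\<lambda>v. convex hull (ref_vertices - {v})) ` ref_vertices"

definition ref_barycenter :: "real^3" where
  "ref_barycenter = (\<chi> m. 1/4)"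

definition ref_triangle :: "(real^2) set" where
  "ref_triangle = {u. 0 \<le> u$1 \<and> 0 \<le> u$2 \<and> u$1 + u$2 \<le> 1}"

definition C1_on :: "('a::euclidean_space \<Rightarrow> 'b::euclidean_space) \<Rightarrow> 'a set \<Rightarrow> bool" where
  "C1_on f U \<longleftrightarrow> open U \<and> (\<forall>x\<in>U. f differentiable (at x)) \<and>
     (\<forall>v. continuous_on U (\<lambda>x. frechet_derivative f (at x) v))"

text \<open>
  Elements are numbered \<open>0, \<dots>, num_elems - 1\<close> and faces \<open>0, \<dots>, num_faces - 1\<close>.
  No finite mesh of compact tetrahedra embedded in \<open>real^3\<close> has a neighbour across every face;
  such meshes arise by identifying opposite boundary faces periodically.  Therefore every face
  carries a translation \<open>shift j\<close>: the face \<open>j\<close> and its dual element are placed next to the left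
  element, and the right element adjoins the face after translation by \<open>shift j\<close>.  With
  \<open>shift j = 0\<close> the face is an ordinary common face of its two elements.

  \<open>face_map j\<close> is a regular parametrisation of face \<open>j\<close> over \<open>ref_triangle\<close>, used to define
  the surface integral; \<open>normal j\<close> is \<open>n_j\<close> (from left to right) and \<open>out_normal i j\<close> is
  \<open>n_ij\<close>, both as fields on face \<open>j\<close>.
  \<open>center j\<close> and \<open>char_len j\<close> are the reference point and the length scale of the
  basis functions on the dual element.
\<close>

record dg_mesh =
  num_elems  :: nat
  num_faces  :: nat
  elem       :: "nat \<Rightarrow> (real^3) set"
  ref_map    :: "nat \<Rightarrow> real^3 \<Rightarrow> real^3"
  face_map   :: "nat \<Rightarrow> real^2 \<Rightarrow> real^3"
  left_elem  :: "nat \<Rightarrow> nat"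
  right_elem :: "nat \<Rightarrow> nat"
  shift      :: "nat \<Rightarrow> real^3"
  normal     :: "nat \<Rightarrow> real^3 \<Rightarrow> real^3"
  out_normal :: "nat \<Rightarrow> nat \<Rightarrow> real^3 \<Rightarrow> real^3"
  center     :: "nat \<Rightarrow> real^3"
  char_len   :: "nat \<Rightarrow> real"

definition face :: "dg_mesh \<Rightarrow> nat \<Rightarrow> (real^3) set" where
  "face M j = face_map M j ` ref_triangle"

text \<open>Translation that moves element \<open>i\<close> to its position at face \<open>j\<close>.\<close>

definition offset :: "dg_mesh \<Rightarrow> nat \<Rightarrow> nat \<Rightarrow> real^3" where
  "offset M i j = (if i = right_elem M j then shift M j else 0)"

definition elem_at :: "dg_mesh \<Rightarrow> nat \<Rightarrow> nat \<Rightarrow> (real^3) set" where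
  "elem_at M i j = (\<lambda>x. x + offset M i j) ` elem M i"

definition ref_map_at :: "dg_mesh \<Rightarrow> nat \<Rightarrow> nat \<Rightarrow> real^3 \<Rightarrow> real^3" where
  "ref_map_at M i j x = ref_map M i (x - offset M i j)"

definition faces_of :: "dg_mesh \<Rightarrow> nat \<Rightarrow> nat set" where
  "faces_of M i = {j. j < num_faces M \<and> (i = left_elem M j \<or> i = right_elem M j)}"

definition elem_faces :: "dg_mesh \<Rightarrow> nat \<Rightarrow> (real^3) set set" where
  "elem_faces M i = (\<lambda>f. {x \<in> elem M i. ref_map M i x \<in> f}) ` ref_faces"

definition neighbour :: "dg_mesh \<Rightarrow> nat \<Rightarrow> nat \<Rightarrow> nat" where
  "neighbour M i j = (if i = left_elem M j then right_elem M j else left_elem M j)"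

definition sigma :: "dg_mesh \<Rightarrow> nat \<Rightarrow> nat \<Rightarrow> real" where
  "sigma M i j = (real (right_elem M j) - 2 * real i + real (left_elem M j))
                   / (real (right_elem M j) - real (left_elem M j))"

text \<open>
  The tetrahedron spanned by the barycenter of element \<open>i\<close> and face \<open>j\<close>; for a curved element it
  is, like the element itself, the image of the corresponding straight tetrahedron in the
  reference element.
\<close>

definition sub_tet :: "dg_mesh \<Rightarrow> nat \<Rightarrow> nat \<Rightarrow> (real^3) set" where
  "sub_tet M i j = {x \<in> elem_at M i j.
     ref_map_at M i j x \<in> convex hull (insert ref_barycenter (ref_map_at M i j ` face M j))}"

definition dual_elem :: "dg_mesh \<Rightarrow> nat \<Rightarrow> (real^3) set" where
  "dual_elem M j = sub_tet M (left_elem M j) j \<union> sub_tet M (right_elem M j) j"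

definition dual_part :: "dg_mesh \<Rightarrow> nat \<Rightarrow> nat \<Rightarrow> (real^3) set" where
  "dual_part M i j = dual_elem M j \<inter> elem_at M i j"

definition tangent :: "dg_mesh \<Rightarrow> nat \<Rightarrow> 2 \<Rightarrow> real^2 \<Rightarrow> real^3" where
  "tangent M j m u = frechet_derivative (face_map M j) (at u) (axis m 1)"

definition unit_normal_at :: "dg_mesh \<Rightarrow> nat \<Rightarrow> real^2 \<Rightarrow> real^3 \<Rightarrow> bool" where
  "unit_normal_at M j u n \<longleftrightarrow> norm n = 1 \<and> (\<forall>m. n \<bullet> tangent M j m u = 0)"

text \<open>
  The directions of the normals are prescribed at the relative interior points of the faces only:
  at an edge, a segment normal to the face may leave the element on both sides.
\<close>

definition valid_mesh :: "dg_mesh \<Rightarrow> bool" where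
  "valid_mesh M \<longleftrightarrow>
    (\<forall>i < num_elems M.
       bij_betw (ref_map M i) (elem M i) ref_tet \<and>
       (\<exists>U. elem M i \<subseteq> U \<and> C1_on (ref_map M i) U \<and> inj_on (ref_map M i) U \<and>
            (\<forall>x\<in>U. bij (frechet_derivative (ref_map M i) (at x)))) \<and>
       (\<forall>i' < num_elems M. i \<noteq> i' \<longrightarrow> interior (elem M i) \<inter> interior (elem M i') = {}) \<and>
       bij_betw (\<lambda>j. (\<lambda>x. x - offset M i j) ` face M j) (faces_of M i) (elem_faces M i)) \<and>
    (\<forall>j < num_faces M.
       left_elem M j < num_elems M \<and> right_elem M j < num_elems M \<and>
       left_elem M j \<noteq> right_elem M j \<and>
       interior (elem_at M (left_elem M j) j) \<inter> interior (elem_at M (right_elem M j) j) = {} \<and>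
       inj_on (face_map M j) ref_triangle \<and>
       (\<exists>V. ref_triangle \<subseteq> V \<and> C1_on (face_map M j) V) \<and>
       (\<forall>u\<in>ref_triangle. cross3 (tangent M j 1 u) (tangent M j 2 u) \<noteq> 0) \<and>
       (\<forall>u \<in> interior ref_triangle. let x = face_map M j u; n = normal M j x in
          unit_normal_at M j u n \<and>
          (\<forall>\<^sub>F \<epsilon> in at_right 0. x - \<epsilon> *\<^sub>R n \<in> elem_at M (left_elem M j) j \<and>
                               x + \<epsilon> *\<^sub>R n \<in> elem_at M (right_elem M j) j)) \<and>
       (\<forall>i \<in> {left_elem M j, right_elem M j}. \<forall>u \<in> interior ref_triangle.
          let x = face_map M j u; n = out_normal M i j x in
          unit_normal_at M j u n \<and>
          (\<forall>\<^sub>F \<epsilon> in at_right 0. x - \<epsilon> *\<^sub>R n \<in> elem_at M i j \<and> x + \<epsilon> *\<^sub>R n \<notin> elem_at M i j)) \<and>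
       0 < char_len M j)"


section \<open>Basis functions\<close>

definition multi_indices :: "nat \<Rightarrow> (nat \<times> nat \<times> nat) list" where
  "multi_indices p = [(a, b, c). a \<leftarrow> [0..<p+1], b \<leftarrow> [0..<p+1-a], c \<leftarrow> [0..<p+1-a-b]]"

definition n_space :: "nat \<Rightarrow> nat" where
  "n_space p = (p + 1) * (p + 2) * (p + 3) div 6"

fun monomial :: "nat \<times> nat \<times> nat \<Rightarrow> real^3 \<Rightarrow> real" where
  "monomial (a, b, c) x = x$1 ^ a * x$2 ^ b * x$3 ^ c"

fun total_deg :: "nat \<times> nat \<times> nat \<Rightarrow> nat" where
  "total_deg (a, b, c) = a + b + c"

definition poly_space :: "nat \<Rightarrow> (real^3 \<Rightarrow> real) set" where
  "poly_space p = range (\<lambda>c x. \<Sum>\<alpha>\<in>set (multi_indices p). c \<alpha> * monomial \<alpha> x)"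

text \<open>For \<open>p = 0\<close> the only node is the origin, since \<open>0 / 0 = 0\<close>.\<close>

fun node :: "nat \<Rightarrow> nat \<times> nat \<times> nat \<Rightarrow> real^3" where
  "node p (a, b, c) = vector [real a / real p, real b / real p, real c / real p]"

text \<open>The choice is unique because interpolation at these nodes is unisolvent.\<close>

definition lagrange_basis :: "nat \<Rightarrow> nat \<Rightarrow> real^3 \<Rightarrow> real" where
  "lagrange_basis p k = (SOME f. f \<in> poly_space p \<and>
     (\<forall>l < n_space p. f (node p (multi_indices p ! l)) = (if l = k then 1 else 0)))"

text \<open>Rodrigues' formula, without the normalising constant.\<close>

definition legendre_poly :: "nat \<Rightarrow> real poly" where
  "legendre_poly n = (pderiv ^^ n) ([:-1, 0, 1:] ^ n)"

definition gauss_nodes :: "nat \<Rightarrow> real list" where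
  "gauss_nodes n = sorted_list_of_set {\<tau>. poly (legendre_poly n) (2 * \<tau> - 1) = 0}"

definition time_basis :: "nat \<Rightarrow> nat \<Rightarrow> real \<Rightarrow> real" where
  "time_basis q m \<tau> = (\<Prod>l\<in>{..q} - {m}.
     (\<tau> - gauss_nodes (q+1) ! l) / (gauss_nodes (q+1) ! m - gauss_nodes (q+1) ! l))"

text \<open>
  Discretisation parameters: degree in space, degree in time, and the end points of the time
  interval.  A space-time index \<open>k\<close> consists of the spatial index \<open>k mod n_space\<close> and the temporal
  index \<open>k div n_space\<close>.
\<close>

record dg_params =
  sdeg :: nat
  tdeg :: nat
  t_old :: real
  t_new :: real

definition n_st :: "dg_params \<Rightarrow> nat" where
  "n_st P = n_space (sdeg P) * (tdeg P + 1)"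

definition t_int :: "dg_params \<Rightarrow> real set" where
  "t_int P = {t_old P .. t_new P}"

definition time_factor :: "dg_params \<Rightarrow> nat \<Rightarrow> real \<Rightarrow> real" where
  "time_factor P k t =
     time_basis (tdeg P) (k div n_space (sdeg P)) ((t - t_old P) / (t_new P - t_old P))"

definition phi :: "dg_mesh \<Rightarrow> dg_params \<Rightarrow> nat \<Rightarrow> nat \<Rightarrow> real^3 \<Rightarrow> real \<Rightarrow> real" where
  "phi M P i k x t =
     lagrange_basis (sdeg P) (k mod n_space (sdeg P)) (ref_map M i x) * time_factor P k t"

text \<open>The function \<open>phi\<close> of element \<open>i\<close>, with the element moved to its position at face \<open>j\<close>.\<close>

definition phi_at :: "dg_mesh \<Rightarrow> dg_params \<Rightarrow> nat \<Rightarrow> nat \<Rightarrow> nat \<Rightarrow> real^3 \<Rightarrow> real \<Rightarrow> real" where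
  "phi_at M P i j k x t = phi M P i k (x - offset M i j) t"

definition psi :: "dg_mesh \<Rightarrow> dg_params \<Rightarrow> nat \<Rightarrow> nat \<Rightarrow> real^3 \<Rightarrow> real \<Rightarrow> real" where
  "psi M P j k x t =
     (let \<alpha> = multi_indices (sdeg P) ! (k mod n_space (sdeg P))
      in monomial \<alpha> (x - center M j) / char_len M j ^ total_deg \<alpha>) * time_factor P k t"


section \<open>Matrices\<close>

definition grad :: "(real^3 \<Rightarrow> real) \<Rightarrow> real^3 \<Rightarrow> real^3" where
  "grad f x = (\<chi> m. frechet_derivative f (at x) (axis m 1))"

definition vol_int_st ::
  "dg_params \<Rightarrow> (real^3) set \<Rightarrow> (real^3 \<Rightarrow> real \<Rightarrow> 'b::euclidean_space) \<Rightarrow> 'b" where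
  "vol_int_st P A f = set_lebesgue_integral lborel (A \<times> t_int P) (\<lambda>(x, t). f x t)"

definition surf_int_st ::
  "dg_mesh \<Rightarrow> dg_params \<Rightarrow> nat \<Rightarrow> (real^3 \<Rightarrow> real \<Rightarrow> 'b::euclidean_space) \<Rightarrow> 'b" where
  "surf_int_st M P j f = set_lebesgue_integral lborel (interior ref_triangle \<times> t_int P)
     (\<lambda>(u, t). norm (cross3 (tangent M j 1 u) (tangent M j 2 u)) *\<^sub>R f (face_map M j u) t)"

definition mass_elem :: "dg_mesh \<Rightarrow> dg_params \<Rightarrow> nat \<Rightarrow> real mat" where
  "mass_elem M P i = Matrix.mat (n_st P) (n_st P) (\<lambda>(k, l).
     set_lebesgue_integral lborel (elem M i) (\<lambda>x. phi M P i k x (t_new P) * phi M P i l x (t_new P))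
     - vol_int_st P (elem M i) (\<lambda>x t. deriv (phi M P i k x) t * phi M P i l x t))"

definition mass_dual :: "dg_mesh \<Rightarrow> dg_params \<Rightarrow> nat \<Rightarrow> real mat" where
  "mass_dual M P j = Matrix.mat (n_st P) (n_st P) (\<lambda>(k, l).
     vol_int_st P (dual_elem M j) (\<lambda>x t. psi M P j k x t * psi M P j l x t))"

definition D_mat :: "dg_mesh \<Rightarrow> dg_params \<Rightarrow> nat \<Rightarrow> nat \<Rightarrow> (real^3) mat" where
  "D_mat M P i j = Matrix.mat (n_st P) (n_st P) (\<lambda>(k, l).
     surf_int_st M P j (\<lambda>x t. (phi_at M P i j k x t * psi M P j l x t) *\<^sub>R out_normal M i j x)
     - vol_int_st P (dual_part M i j)
         (\<lambda>x t. psi M P j l x t *\<^sub>R grad (\<lambda>y. phi_at M P i j k y t) x))"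

definition Q_mat :: "dg_mesh \<Rightarrow> dg_params \<Rightarrow> nat \<Rightarrow> nat \<Rightarrow> (real^3) mat" where
  "Q_mat M P i j = Matrix.mat (n_st P) (n_st P) (\<lambda>(k, l).
     vol_int_st P (dual_part M i j)
       (\<lambda>x t. psi M P j k x t *\<^sub>R grad (\<lambda>y. phi_at M P i j l y t) x)
     - surf_int_st M P j (\<lambda>x t. (psi M P j k x t * phi_at M P i j l x t)
                               *\<^sub>R (sigma M i j *\<^sub>R normal M j x)))"

text \<open>The product of \<open>D\<close> of element \<open>i\<close>, the inverse dual mass matrix, and \<open>Q\<close> of element \<open>i'\<close>.\<close>

definition DMQ :: "dg_mesh \<Rightarrow> dg_params \<Rightarrow> nat \<Rightarrow> nat \<Rightarrow> nat \<Rightarrow> real mat" where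
  "DMQ M P i i' j = Matrix.mat (n_st P) (n_st P) (\<lambda>(k, l).
     \<Sum>a<n_st P. \<Sum>b<n_st P. the (mat_inverse (mass_dual M P j)) $$ (a, b)
       * (D_mat M P i j $$ (k, a) \<bullet> Q_mat M P i' j $$ (b, l)))"

text \<open>
  Entry \<open>(k, l)\<close> of the block in block row \<open>i\<close> and block column \<open>i'\<close>.  Two elements may share
  several faces (in a periodic mesh), whence the second sum.
\<close>

definition viscous_block ::
  "dg_mesh \<Rightarrow> dg_params \<Rightarrow> real \<Rightarrow> nat \<Rightarrow> nat \<Rightarrow> nat \<Rightarrow> nat \<Rightarrow> real" where
  "viscous_block M P \<nu> i i' k l =
     (if i = i' then mass_elem M P i $$ (k, l) - \<nu> * (\<Sum>j\<in>faces_of M i. DMQ M P i i j $$ (k, l))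
      else 0)
     - \<nu> * (\<Sum>j\<in>{j \<in> faces_of M i. neighbour M i j = i'}. DMQ M P i (neighbour M i j) j $$ (k, l))"

definition viscous_matrix :: "dg_mesh \<Rightarrow> dg_params \<Rightarrow> real \<Rightarrow> real mat" where
  "viscous_matrix M P \<nu> = Matrix.mat (num_elems M * n_st P) (num_elems M * n_st P) (\<lambda>(r, c).
     viscous_block M P \<nu> (r div n_st P) (c div n_st P) (r mod n_st P) (c mod n_st P))"

end

theory Submission
  imports Defs "Jordan_Normal_Form.Determinant"
begin

text \<open>
  On each face \<open>n_ij = \<sigma>_ij n_j\<close>, because both are unit normals and the prescribed sides agree;
  hence \<open>D_ij\<close> is the negative transpose of \<open>Q_ij\<close>.  With \<open>w_j = Q_lj x_l + Q_rj x_r\<close>, where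
  \<open>l\<close> and \<open>r\<close> are the left and right elements of face \<open>j\<close>, the four viscous terms attached to \<open>j\<close>
  complete a square, and the quadratic form of the system becomes
  \<open>\<Sum>_i x_i \<bullet> M_i x_i + \<nu> \<Sum>_j w_j \<bullet> M_j\<^sup>-\<^sup>1 w_j\<close>.  For basis functions that are constant in time
  the time derivative in \<open>M_i\<close> drops out, so that \<open>M_i\<close> and \<open>M_j\<close> are Gram matrices of functions
  that are linearly independent on the interior of a compact set.
\<close>

(* The second import restores these notations, which Defs removes. *)
no_notation Matrix.vec_index (infixl "$" 100)
no_notation Matrix.scalar_prod (infix "\<bullet>" 70)

section \<open>Quadratic forms\<close>

text \<open>Splits a global index into the element \<open>i\<close> and the local index
  \<open>k\<close>, in the same way as \<open>div\<close> and \<open>mod\<close> do in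
  \<open>viscous_matrix\<close>.\<close>

lemma sum_mult_nat_group:
  fixes f :: "nat \<Rightarrow> 'a::comm_monoid_add"
  shows "(\<Sum>r<m * n. f r) = (\<Sum>i<m. \<Sum>k<n. f (i * n + k))"
proof -
  have "(\<Sum>k<n. f (i * n + k)) = sum f {i * n..<i * n + n}" for i
    by (rule sum.reindex_bij_witness[of _ "\<lambda>r. r - i * n" "\<lambda>k. i * n + k"]) auto
  then show ?thesis
    by (simp add: sum.nat_group)
qed

lemma mat_quadratic_form:
  fixes A :: "'a::comm_semiring_0 mat"
  assumes "A \<in> carrier_mat n n" "x \<in> carrier_vec n"
  shows "scalar_prod x (A *\<^sub>v x)
    = (\<Sum>r<n. \<Sum>c<n. vec_index x r * A $$ (r, c) * vec_index x c)"
  using assms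
  by (auto simp: scalar_prod_def atLeast0LessThan sum_distrib_left mult.assoc intro!: sum.cong)

text \<open>Substituting \<open>z = B w\<close> turns the form of the inverse \<open>B\<close> at
  \<open>w\<close> into the form of \<open>A\<close> at \<open>z\<close>. Positive definiteness
  makes \<open>A\<close> injective, so that the inverse exists and \<open>the\<close> never meets
  \<open>None\<close>.\<close>

lemma pos_def_mat_inverse:
  fixes A :: "real mat"
  assumes A: "A \<in> carrier_mat n n"
    and pd: "\<And>x. x \<in> carrier_vec n \<Longrightarrow> x \<noteq> 0\<^sub>v n \<Longrightarrow> 0 < scalar_prod x (A *\<^sub>v x)"
  shows "0 \<le> (\<Sum>a<n. \<Sum>b<n. the (mat_inverse A) $$ (a, b) * (y a * y b))"
proof -
  have "Determinant.det A \<noteq> 0"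
  proof
    assume "Determinant.det A = 0"
    then obtain v where v: "v \<in> carrier_vec n" "v \<noteq> 0\<^sub>v n" "A *\<^sub>v v = 0\<^sub>v n"
      using det_0_iff_vec_prod_zero_field[OF A] by blast
    with pd[OF v(1,2)] show False by simp
  qed
  \<comment> \<open>A result \<open>None\<close> would mean that \<open>A\<close> is not a unit of
    the matrix ring; \<open>"()"\<close> instantiates the extension field of the record for that
    ring.\<close>
  from det_non_zero_imp_unit[OF A this, of "()"] mat_inverse(1)[OF A, of "()"]
  obtain B where inv: "mat_inverse A = Some B" by fastforce
  from mat_inverse(2)[OF A inv] have AB: "A * B = 1\<^sub>m n" and B: "B \<in> carrier_mat n n" by auto
  define w where "w = Matrix.vec n y"
  have w: "w \<in> carrier_vec n" by (simp add: w_def)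
  define z where "z = B *\<^sub>v w"
  have z: "z \<in> carrier_vec n" unfolding z_def by (rule mult_mat_vec_carrier[OF B w])
  have Az: "A *\<^sub>v z = w"
    using assoc_mult_mat_vec[OF A B w] AB w by (simp add: z_def)
  have "(\<Sum>a<n. \<Sum>b<n. B $$ (a, b) * (y a * y b)) = scalar_prod w (B *\<^sub>v w)"
    unfolding mat_quadratic_form[OF B w] by (intro sum.cong refl) (auto simp: w_def)
  also have "\<dots> = scalar_prod z (A *\<^sub>v z)"
    unfolding z_def[symmetric] Az by (rule comm_scalar_prod[OF w z])
  also have "\<dots> \<ge> 0"
    by (cases "z = 0\<^sub>v n") (use A z pd[of z] in auto)
  finally show ?thesis by (simp add: inv)
qed

section \<open>Gram matrices\<close>

text \<open>A nonnegative function with integral zero vanishes almost everywhere, and the interior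
  points where \<open>h\<close> is nonzero form an open set. An open null set is empty.\<close>

lemma set_integral_square_eq_0:
  fixes h :: "'a::euclidean_space \<Rightarrow> real"
  assumes A: "compact A" and h: "continuous_on A h"
    and 0: "set_lebesgue_integral lborel A (\<lambda>x. (h x)\<^sup>2) = 0" and x: "x \<in> interior A"
  shows "h x = 0"
proof -
  let ?f = "\<lambda>x. indicator A x *\<^sub>R (h x)\<^sup>2"
  have "integrable lborel ?f"
    by (intro borel_integrable_compact A continuous_intros h)
  with 0 have "AE x in lborel. ?f x = 0"
    by (subst integral_nonneg_eq_0_iff_AE[symmetric]) (auto simp: set_lebesgue_integral_def)
  moreover define V where "V = {x \<in> interior A. h x \<in> - {0}}"
  have "open V"
    using continuous_open_preimage[OF continuous_on_subset[OF h interior_subset], of "- {0}"]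
    by (simp add: V_def vimage_def Int_def open_Compl)
  moreover have "V \<subseteq> {x. ?f x \<noteq> 0}"
    using interior_subset[of A] by (auto simp: V_def)
  \<comment> \<open>\<open>negligible\<close> refers to the completed measure, hence the passage
    from \<open>lborel\<close> to its completion.\<close>
  ultimately have "negligible V"
    by (auto simp: negligible_iff_null_sets AE_iff_null_sets AE_completion_iff 
        intro!: AE_completion elim!: eventually_mono)
  with \<open>open V\<close> have "V = {}" by (metis open_not_negligible)
  with x show ?thesis by (auto simp: V_def)
qed

text \<open>Expands the square and exchanges the finite sums with the integral; continuity on a
  compact set makes every product integrable.\<close>

lemma gram_form:
  fixes g :: "nat \<Rightarrow> 'a::euclidean_space \<Rightarrow> real"
  assumes A: "compact A" and g: "\<And>k. k < n \<Longrightarrow> continuous_on A (g k)"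
  shows "(\<Sum>k<n. \<Sum>l<n. c k * set_lebesgue_integral lborel A (\<lambda>x. g k x * g l x) * c l)
    = set_lebesgue_integral lborel A (\<lambda>x. (\<Sum>k<n. c k * g k x)\<^sup>2)"
proof -
  let ?i = "indicator A :: 'a \<Rightarrow> real"
  have int: "integrable lborel (\<lambda>x. ?i x *\<^sub>R (g k x * g l x))" if "k < n" "l < n" for k l
    by (intro borel_integrable_compact A continuous_intros g that)
  have int': "integrable lborel (\<lambda>x. c k * (?i x *\<^sub>R (g k x * g l x)) * c l)"
    if "k < n" "l < n" for k l
    using int[OF that] by (intro integrable_mult_left integrable_mult_right)
  have "(\<Sum>k<n. \<Sum>l<n. c k * set_lebesgue_integral lborel A (\<lambda>x. g k x * g l x) * c l)
    = (\<Sum>k<n. \<Sum>l<n. LINT x|lborel. (c k * (?i x *\<^sub>R (g k x * g l x)) * c l))"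
    unfolding set_lebesgue_integral_def by simp
  also have "\<dots> = (\<Sum>k<n. LINT x|lborel. (\<Sum>l<n. c k * (?i x *\<^sub>R (g k x * g l x)) * c l))"
    by (rule sum.cong[OF refl], rule Bochner_Integration.integral_sum[symmetric])
      (rule int', auto)
  also have "\<dots> = (LINT x|lborel. (\<Sum>k<n. \<Sum>l<n. c k * (?i x *\<^sub>R (g k x * g l x)) * c l))"
    by (rule Bochner_Integration.integral_sum[symmetric], rule Bochner_Integration.integrable_sum)
      (rule int', auto)
  also have "\<dots> = set_lebesgue_integral lborel A (\<lambda>x. (\<Sum>k<n. c k * g k x)\<^sup>2)"
    unfolding set_lebesgue_integral_def power2_eq_square sum_product
    by (simp add: sum_distrib_left ac_simps)
  finally show ?thesis .
qed

text \<open>Independence is asked on \<open>interior A\<close>, which is where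
  \<open>set_integral_square_eq_0\<close> makes the combination vanish.\<close>

lemma gram_pos_def:
  fixes g :: "nat \<Rightarrow> 'a::euclidean_space \<Rightarrow> real"
  assumes A: "compact A" and g: "\<And>k. k < n \<Longrightarrow> continuous_on A (g k)"
    and indep: "\<And>k. (\<And>x. x \<in> interior A \<Longrightarrow> (\<Sum>l<n. c l * g l x) = 0) \<Longrightarrow> k < n \<Longrightarrow> c k = 0"
  shows "0 \<le> (\<Sum>k<n. \<Sum>l<n. c k * set_lebesgue_integral lborel A (\<lambda>x. g k x * g l x) * c l)"
      (is "0 \<le> ?S")
    and "\<exists>k<n. c k \<noteq> 0 \<Longrightarrow>
      0 < (\<Sum>k<n. \<Sum>l<n. c k * set_lebesgue_integral lborel A (\<lambda>x. g k x * g l x) * c l)"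
proof -
  have form: "?S = set_lebesgue_integral lborel A (\<lambda>x. (\<Sum>k<n. c k * g k x)\<^sup>2)"
    by (rule gram_form[OF A g])
  have "0 \<le> set_lebesgue_integral lborel A (\<lambda>x. (\<Sum>k<n. c k * g k x)\<^sup>2)"
    unfolding set_lebesgue_integral_def by (intro Bochner_Integration.integral_nonneg) auto
  then show nonneg: "0 \<le> ?S"
    by (simp only: form)
  assume ex: "\<exists>k<n. c k \<noteq> 0"
  have "?S \<noteq> 0"
  proof
    assume "?S = 0"
    then have "set_lebesgue_integral lborel A (\<lambda>x. (\<Sum>k<n. c k * g k x)\<^sup>2) = 0"
      by (simp only: form)
    moreover have "continuous_on A (\<lambda>x. \<Sum>k<n. c k * g k x)"
      by (intro continuous_on_sum continuous_on_mult continuous_on_const g) simp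
    ultimately have "(\<Sum>k<n. c k * g k x) = 0" if "x \<in> interior A" for x
      using set_integral_square_eq_0[OF A _ _ that] by blast
    from indep[OF this] ex show False by blast
  qed
  with nonneg show "0 < ?S" by simp
qed

section \<open>Polynomials and Lagrange interpolation\<close>

lemma set_multi_indices: "set (multi_indices p) = {(a, b, c). a + b + c \<le> p}"
  by (auto simp: multi_indices_def image_iff simp del: upt_Suc)

text \<open>The tag \<open>t\<close> recovers from an entry the \<open>x\<close> whose list contains
  it, so that the lists of different \<open>x\<close> are disjoint. For multi-indices the tags are
  the first two components.\<close>

lemma distinct_concat_map_tagged:
  assumes "distinct xs" "\<And>x. x \<in> set xs \<Longrightarrow> distinct (f x)"
    "\<And>x y. x \<in> set xs \<Longrightarrow> y \<in> set (f x) \<Longrightarrow> t y = x"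
  shows "distinct (concat (map f xs))"
  using assms
proof (induction xs)
  case (Cons x xs)
  have "set (f x) \<inter> set (concat (map f xs)) = {}"
    using Cons.prems by (auto) (metis)
  with Cons show ?case by auto
qed simp

lemma distinct_multi_indices: "distinct (multi_indices p)"
  unfolding multi_indices_def
  by (intro distinct_concat_map_tagged[where t = fst] distinct_concat_map_tagged[where t = "fst \<circ> snd"])
    (auto simp: distinct_map inj_on_def)

lemma sum_diff_lessThan: "2 * (\<Sum>b<m. m - b) = m * (m + 1 :: nat)"
proof (induction m)
  case (Suc m)
  then show ?case by (simp add: sum.lessThan_Suc_shift del: sum.lessThan_Suc)
qed simp

lemma sum_triangular_diff:
  "3 * (\<Sum>a<n. (n - a) * (n - a + 1)) = n * (n + 1) * (n + 2 :: nat)"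
proof (induction n)
  case (Suc n)
  have "3 * (\<Sum>a<Suc n. (Suc n - a) * (Suc n - a + 1))
    = 3 * ((n + 1) * (n + 2)) + 3 * (\<Sum>a<n. (n - a) * (n - a + 1))"
    by (simp add: sum.lessThan_Suc_shift del: sum.lessThan_Suc)
  then show ?case unfolding Suc.IH by (simp add: algebra_simps)
qed simp

text \<open>The inner sums are triangular numbers and their total is a tetrahedral number. The
  factor 6 = 3 * 2 is carried along so that division occurs only at the end.\<close>

lemma length_multi_indices: "length (multi_indices p) = n_space p"
proof -
  have "length (multi_indices p) = (\<Sum>a<p+1. \<Sum>b<p+1-a. p+1-a-b)"
    unfolding multi_indices_def
    by (simp add: length_concat o_def interv_sum_list_conv_sum_set_nat atLeast0LessThan
        del: upt_Suc)
  moreover have "6 * (\<Sum>a<p+1. \<Sum>b<p+1-a. p+1-a-b) = 3 * (\<Sum>a<p+1. 2 * (\<Sum>b<p+1-a. p+1-a-b))"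
    by (simp add: sum_distrib_left)
  then have "6 * (\<Sum>a<p+1. \<Sum>b<p+1-a. p+1-a-b) = (p+1) * (p+2) * (p+3)"
    unfolding sum_diff_lessThan sum_triangular_diff by (simp add: numeral_eq_Suc)
  ultimately show ?thesis by (simp add: n_space_def)
qed

lemma n_space_pos: "0 < n_space p"
proof -
  have "(0, 0, 0) \<in> set (multi_indices p)" by (simp add: set_multi_indices)
  then show ?thesis by (metis length_multi_indices length_pos_if_in_set)
qed

lemma multi_index_total_deg: "k < n_space p \<Longrightarrow> total_deg (multi_indices p ! k) \<le> p"
  using nth_mem[of k "multi_indices p"] by (auto simp: length_multi_indices set_multi_indices)

lemma bij_betw_multi_indices:
  "bij_betw ((!) (multi_indices p)) {..<n_space p} (set (multi_indices p))"
  by (rule bij_betw_nth) (auto simp: distinct_multi_indices length_multi_indices)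

section \<open>The space of polynomials of bounded total degree\<close>

lemma poly_space_0: "(\<lambda>x. 0) \<in> poly_space p"
  unfolding poly_space_def by (rule image_eqI[of _ _ "\<lambda>_. 0"]) auto

lemma poly_space_add:
  assumes "f \<in> poly_space p" "g \<in> poly_space p"
  shows "(\<lambda>x. f x + g x) \<in> poly_space p"
proof -
  from assms obtain c d where "f = (\<lambda>x. \<Sum>\<alpha>\<in>set (multi_indices p). c \<alpha> * monomial \<alpha> x)"
    "g = (\<lambda>x. \<Sum>\<alpha>\<in>set (multi_indices p). d \<alpha> * monomial \<alpha> x)"
    by (auto simp: poly_space_def)
  then show ?thesis
    unfolding poly_space_def
    by (intro image_eqI[of _ _ "\<lambda>\<alpha>. c \<alpha> + d \<alpha>"]) (auto simp: sum.distrib algebra_simps)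
qed

lemma poly_space_scale:
  assumes "f \<in> poly_space p" shows "(\<lambda>x. r * f x) \<in> poly_space p"
proof -
  from assms obtain c where "f = (\<lambda>x. \<Sum>\<alpha>\<in>set (multi_indices p). c \<alpha> * monomial \<alpha> x)"
    by (auto simp: poly_space_def)
  then show ?thesis
    unfolding poly_space_def
    by (intro image_eqI[of _ _ "\<lambda>\<alpha>. r * c \<alpha>"]) (auto simp: sum_distrib_left ac_simps)
qed

lemma poly_space_sum:
  assumes "\<And>i. i \<in> I \<Longrightarrow> f i \<in> poly_space p"
  shows "(\<lambda>x. \<Sum>i\<in>I. f i x) \<in> poly_space p"
  using assms
  by (induction I rule: infinite_finite_induct) (simp_all add: poly_space_0 poly_space_add)

lemma monomial_in_poly_space:
  assumes "total_deg \<alpha> \<le> p" shows "monomial \<alpha> \<in> poly_space p"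
proof -
  have "\<alpha> \<in> set (multi_indices p)"
    using assms by (cases \<alpha>) (simp add: set_multi_indices)
  then show ?thesis
    unfolding poly_space_def
    by (intro image_eqI[of _ _ "\<lambda>\<beta>. if \<beta> = \<alpha> then 1 else 0"])
      (auto simp: if_distrib[of "\<lambda>c. c * _"] cong: if_cong)
qed

text \<open>A coordinate times a monomial is a monomial of degree one higher, so the coefficients
  are carried over along the index map \<open>s\<close>.\<close>

lemma poly_space_mult_coordinate:
  assumes f: "f \<in> poly_space p" shows "(\<lambda>x. x $ m * f x) \<in> poly_space (Suc p)"
proof -
  from f obtain c where f: "f = (\<lambda>x. \<Sum>\<alpha>\<in>set (multi_indices p). c \<alpha> * monomial \<alpha> x)"
    by (auto simp: poly_space_def)
  have "\<exists>\<beta>. total_deg \<beta> = Suc (total_deg \<alpha>) \<and> (\<forall>x. x $ m * monomial \<alpha> x = monomial \<beta> x)" for \<alpha>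
  proof (cases \<alpha>)
    case (fields a b c)
    consider "m = 1" | "m = 2" | "m = 3" using exhaust_3 by blast
    then show ?thesis
    proof cases
      case 1 then show ?thesis by (intro exI[of _ "(Suc a, b, c)"]) (simp add: fields)
    next
      case 2 then show ?thesis by (intro exI[of _ "(a, Suc b, c)"]) (simp add: fields)
    next
      case 3 then show ?thesis by (intro exI[of _ "(a, b, Suc c)"]) (simp add: fields)
    qed
  qed
  then obtain s where s: "\<And>\<alpha>. total_deg (s \<alpha>) = Suc (total_deg \<alpha>)"
    "\<And>\<alpha> x. x $ m * monomial \<alpha> x = monomial (s \<alpha>) x" by metis
  have "(\<lambda>x. x $ m * f x) = (\<lambda>x. \<Sum>\<alpha>\<in>set (multi_indices p). c \<alpha> * monomial (s \<alpha>) x)"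
    by (simp add: f sum_distrib_left mult.left_commute[of "_ $ m"] s(2))
  also have "\<dots> \<in> poly_space (Suc p)"
    by (intro poly_space_sum poly_space_scale monomial_in_poly_space) (auto simp: s set_multi_indices)
  finally show ?thesis .
qed

lemma poly_space_Suc: "f \<in> poly_space p \<Longrightarrow> f \<in> poly_space (Suc p)"
proof -
  assume "f \<in> poly_space p"
  then obtain c where f: "f = (\<lambda>x. \<Sum>\<alpha>\<in>set (multi_indices p). c \<alpha> * monomial \<alpha> x)"
    by (auto simp: poly_space_def)
  show ?thesis unfolding f
    by (intro poly_space_sum poly_space_scale monomial_in_poly_space) (auto simp: set_multi_indices)
qed

lemma poly_space_mult_affine:
  assumes f: "f \<in> poly_space p"
  shows "(\<lambda>x. (v \<bullet> x + r) * f x) \<in> poly_space (Suc p)"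
proof -
  have "(\<lambda>x. (v \<bullet> x + r) * f x) = (\<lambda>x. (\<Sum>m\<in>UNIV. v $ m * (x $ m * f x)) + r * f x)"
    by (simp add: inner_vec_def sum_distrib_left sum_distrib_right algebra_simps)
  also have "\<dots> \<in> poly_space (Suc p)"
    by (intro poly_space_add poly_space_sum poly_space_scale poly_space_mult_coordinate poly_space_Suc f)
  finally show ?thesis .
qed

text \<open>Counts the degree of the interpolating polynomials, which are built as products of
  affine functions.\<close>

lemma poly_space_prod_affine:
  assumes "f \<in> poly_space p"
  shows "(\<lambda>x. (\<Prod>m<n. v m \<bullet> x + r m) * f x) \<in> poly_space (p + n)"
proof (induction n)
  case (Suc n)
  from poly_space_mult_affine[OF this] show ?case by (simp add: ac_simps)
qed (simp add: assms)

text \<open>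
  In barycentric coordinates multiplied by \<open>p\<close>, the node \<open>(a, b, c)\<close> is \<open>(a, b, c, p - a - b - c)\<close>,
  and \<open>falling a\<close> vanishes at every node whose coordinate is smaller than \<open>a\<close>.  The coordinates of
  every node have the same sum \<open>p\<close>, so that no other node dominates the given one.
\<close>

lemma lagrange_basis_exists:
  assumes k: "k < n_space p"
  shows "\<exists>f \<in> poly_space p. \<forall>l < n_space p.
    f (node p (multi_indices p ! l)) = (if l = k then 1 else 0)"
proof -
  obtain a b c where abc: "multi_indices p ! k = (a, b, c)" by (metis prod_cases3)
  \<comment> \<open>The fourth barycentric coordinate times \<open>p\<close>; the truncated
    subtraction is exact because \<open>a + b + c\<close> is at most \<open>p\<close>.\<close>
  define d where "d = p - a - b - c"
  have sum: "a + b + c + d = p"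
    using multi_index_total_deg[OF k] by (simp add: abc d_def)
  define falling where "falling n s = (\<Prod>m<n. s - real m)" for n s
  have falling_0: "falling n (real s) = 0" if "s < n" for n s
    unfolding falling_def using that by (intro prod_zero) auto
  have falling_n: "falling n (real n) \<noteq> 0" for n
    by (simp add: falling_def)
  \<comment> \<open>Chosen so that the inner product with \<open>x\<close>, plus \<open>p\<close>,
    is \<open>p\<close> times the fourth barycentric coordinate of \<open>x\<close>.\<close>
  define v4 :: "real^3" where "v4 = (\<chi> m. - real p)"
  define g :: "real^3 \<Rightarrow> real" where "g x = falling a (real p * x $ 1) * (falling b (real p * x $ 2)
    * (falling c (real p * x $ 3) * falling d (real p * (1 - x $ 1 - x $ 2 - x $ 3))))" for x
  have 1: "falling n (real p * x $ m) = (\<Prod>i<n. (real p *\<^sub>R axis m 1) \<bullet> x + - real i)"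
    for n m and x :: "real^3"
    by (simp add: falling_def inner_axis inner_commute)
  have 2: "falling n (real p * (1 - x $ 1 - x $ 2 - x $ 3)) = (\<Prod>i<n. v4 \<bullet> x + (real p - real i))"
    for n and x :: "real^3"
    by (simp add: falling_def inner_vec_def v4_def sum_3 algebra_simps)
  have "monomial (0, 0, 0) = (\<lambda>x. 1)"
    by (simp add: fun_eq_iff)
  then have one: "(\<lambda>x. 1) \<in> poly_space 0"
    using monomial_in_poly_space[of "(0, 0, 0)" 0] by simp
  \<comment> \<open>The four groups of affine factors are multiplied onto the constant 1, innermost
    first; their numbers add up to the degree \<open>p\<close>.\<close>
  have "g \<in> poly_space (0 + d + c + b + a)"
    using poly_space_prod_affine[OF poly_space_prod_affine[OF poly_space_prod_affine[OF
          poly_space_prod_affine[OF one, where v = "\<lambda>_. v4" and r = "\<lambda>i. real p - real i" and n = d],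
          where v = "\<lambda>_. real p *\<^sub>R axis 3 1" and r = "\<lambda>i. - real i" and n = c],
        where v = "\<lambda>_. real p *\<^sub>R axis 2 1" and r = "\<lambda>i. - real i" and n = b],
      where v = "\<lambda>_. real p *\<^sub>R axis 1 1" and r = "\<lambda>i. - real i" and n = a]
    unfolding g_def 1 2 by simp
  then have g: "g \<in> poly_space p" using sum by (simp add: ac_simps)
  have val: "g (node p (a', b', c')) = falling a (real a') * (falling b (real b')
      * (falling c (real c') * falling d (real (p - a' - b' - c'))))"
    if "a' + b' + c' \<le> p" for a' b' c'
  proof -
    \<comment> \<open>For \<open>p = 0\<close> the cancellation fails, but then \<open>a'\<close>,
      \<open>b'\<close> and \<open>c'\<close> are 0 and both sides are 0.\<close>
    have "real p * (real a' / real p) = real a'" "real p * (real b' / real p) = real b'"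
      "real p * (real c' / real p) = real c'"
      using that by auto
    moreover from this have "real p * (1 - real a' / real p - real b' / real p - real c' / real p)
        = real (p - a' - b' - c')"
      using that by (simp add: right_diff_distrib)
    ultimately show ?thesis
      by (simp add: g_def)
  qed
  have sum_le: "a + b + c \<le> p" using sum by simp
  have nz: "g (node p (a, b, c)) \<noteq> 0"
    unfolding val[OF sum_le] d_def[symmetric] using falling_n by simp
  have z: "g (node p (multi_indices p ! l)) = 0" if l: "l < n_space p" "l \<noteq> k" for l
  proof -
    obtain a' b' c' where abc': "multi_indices p ! l = (a', b', c')" by (metis prod_cases3)
    have le: "a' + b' + c' \<le> p"
      using multi_index_total_deg[OF l(1)] by (simp add: abc')
    have "(a', b', c') \<noteq> (a, b, c)"
      using l k distinct_multi_indices[of p] unfolding abc'[symmetric] abc[symmetric]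
      by (simp add: nth_eq_iff_index_eq length_multi_indices)
    then have "a' < a \<or> b' < b \<or> c' < c \<or> p - a' - b' - c' < d"
      using le sum by auto
    then show ?thesis
      unfolding abc' val[OF le] using falling_0 by auto
  qed
  show ?thesis
    using poly_space_scale[OF g, of "1 / g (node p (a, b, c))"] z nz
    by (intro bexI[of _ "\<lambda>x. 1 / g (node p (a, b, c)) * g x"]) (auto simp: abc)
qed

text \<open>Existence of an interpolating polynomial passes the defining properties on to the
  \<open>SOME\<close> term.\<close>

lemma lagrange_basis:
  assumes "k < n_space p"
  shows "lagrange_basis p k \<in> poly_space p"
    and "l < n_space p \<Longrightarrow>
      lagrange_basis p k (node p (multi_indices p ! l)) = (if l = k then 1 else 0)"
  using someI_ex[OF lagrange_basis_exists[OF assms, unfolded Bex_def]]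
  unfolding lagrange_basis_def by auto

section \<open>Linear independence on nonempty open sets\<close>

lemma polyfun_zero_on_infinite:
  fixes c :: "nat \<Rightarrow> real"
  assumes "infinite S" "\<And>x. x \<in> S \<Longrightarrow> (\<Sum>i\<le>n. c i * x ^ i) = 0" "k \<le> n"
  shows "c k = 0"
proof (rule ccontr)
  assume "c k \<noteq> 0"
  then have "finite {x. (\<Sum>i\<le>n. c i * x ^ i) = 0}"
    using polyfun_roots_finite[of c k n] assms(3) by auto
  moreover have "S \<subseteq> {x. (\<Sum>i\<le>n. c i * x ^ i) = 0}"
    using assms(2) by (intro subsetI CollectI)
  ultimately show False
    using assms(1) finite_subset by metis
qed

text \<open>\<open>W\<close> contains a box. With two coordinates fixed the sum is a univariate
  polynomial with infinitely many zeros; comparing coefficients in the first, second and third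
  coordinate in turn isolates each coefficient.\<close>

lemma monomials_independent:
  assumes W: "open W" "W \<noteq> {}"
    and zero: "\<And>x. x \<in> W \<Longrightarrow> (\<Sum>\<alpha>\<in>set (multi_indices p). c \<alpha> * monomial \<alpha> x) = 0"
    and \<alpha>: "\<alpha> \<in> set (multi_indices p)"
  shows "c \<alpha> = 0"
proof -
  \<comment> \<open>Extension of \<open>c\<close> by zero from the simplex of multi-indices to a
    cube, which turns the sum into nested univariate polynomials.\<close>
  define C where "C a b d = (if a + b + d \<le> p then c (a, b, d) else 0)" for a b d
  have eq: "(\<Sum>\<alpha>\<in>set (multi_indices p). c \<alpha> * monomial \<alpha> x)
    = (\<Sum>a\<le>p. (\<Sum>b\<le>p. (\<Sum>d\<le>p. C a b d * x $ 3 ^ d) * x $ 2 ^ b) * x $ 1 ^ a)" for x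
  proof -
    have "(\<Sum>a\<le>p. (\<Sum>b\<le>p. (\<Sum>d\<le>p. C a b d * x $ 3 ^ d) * x $ 2 ^ b) * x $ 1 ^ a)
      = (\<Sum>(a, b, d)\<in>{..p} \<times> {..p} \<times> {..p}. C a b d * monomial (a, b, d) x)"
      by (simp add: sum.cartesian_product[symmetric] sum_distrib_left sum_distrib_right ac_simps)
    also have "\<dots> = (\<Sum>\<alpha>\<in>set (multi_indices p). c \<alpha> * monomial \<alpha> x)"
      by (rule sum.mono_neutral_cong_right) (auto simp: set_multi_indices C_def split: if_splits)
    finally show ?thesis ..
  qed
  from W obtain x0 where "x0 \<in> W" by blast
  with W(1) obtain e where e: "0 < e" "\<And>y. dist y x0 < e \<Longrightarrow> y \<in> W"
    by (auto simp: open_dist)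
  \<comment> \<open>With \<open>e / 3\<close> in each coordinate the sum of the three deviations,
    which bounds the Euclidean distance to \<open>x0\<close>, stays below \<open>e\<close>.\<close>
  define I where "I m = {x0 $ m <..< x0 $ m + e / 3}" for m
  have inf: "infinite (I m)" for m using e(1) by (simp add: I_def infinite_Ioo)
  have inW: "(vector [x, y, z] :: real^3) \<in> W" if "x \<in> I 1" "y \<in> I 2" "z \<in> I 3" for x y z
  proof (rule e(2))
    have "norm ((vector [x, y, z] :: real^3) - x0)
      \<le> (\<Sum>m\<in>UNIV. \<bar>((vector [x, y, z] :: real^3) - x0) $ m\<bar>)"
      by (rule norm_le_l1_cart)
    also have "\<dots> < e" using that by (auto simp: sum_3 I_def)
    finally show "dist (vector [x, y, z]) x0 < e" by (simp add: dist_norm)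
  qed
  have z: "(\<Sum>a\<le>p. (\<Sum>b\<le>p. (\<Sum>d\<le>p. C a b d * z ^ d) * y ^ b) * x ^ a) = 0"
    if "x \<in> I 1" "y \<in> I 2" "z \<in> I 3" for x y z
    using zero[OF inW[OF that]] unfolding eq by simp
  obtain a b d where abd: "\<alpha> = (a, b, d)" "a + b + d \<le> p"
    using \<alpha> by (auto simp: set_multi_indices)
  have "(\<Sum>b\<le>p. (\<Sum>d\<le>p. C a b d * z ^ d) * y ^ b) = 0" if "y \<in> I 2" "z \<in> I 3" for y z
    using polyfun_zero_on_infinite[OF inf z] that abd by simp
  then have "(\<Sum>d\<le>p. C a b d * z ^ d) = 0" if "z \<in> I 3" for z
    using abd that polyfun_zero_on_infinite[OF inf[of 2],
        where c = "\<lambda>b. \<Sum>d\<le>p. C a b d * z ^ d" and n = p and k = b] by simp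
  then have "C a b d = 0"
    using abd polyfun_zero_on_infinite[OF inf[of 3], where c = "C a b" and n = p and k = d] by simp
  then show ?thesis using abd by (simp add: C_def)
qed

lemma poly_space_zero_on_open:
  assumes f: "f \<in> poly_space p" and W: "open W" "W \<noteq> {}" and zero: "\<And>x. x \<in> W \<Longrightarrow> f x = 0"
  shows "f x = 0"
proof -
  from f obtain c where f: "f = (\<lambda>x. \<Sum>\<alpha>\<in>set (multi_indices p). c \<alpha> * monomial \<alpha> x)"
    by (auto simp: poly_space_def)
  have "c \<alpha> = 0" if "\<alpha> \<in> set (multi_indices p)" for \<alpha>
    using monomials_independent[OF W _ that] zero by (simp add: f)
  then show ?thesis by (simp add: f)
qed

text \<open>The combination is a polynomial, so vanishing on \<open>W\<close> makes it vanish
  everywhere, in particular at the \<open>k\<close>-th node, where its value is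
  \<open>c k\<close>.\<close>

lemma lagrange_basis_independent:
  assumes W: "open W" "W \<noteq> {}"
    and zero: "\<And>x. x \<in> W \<Longrightarrow> (\<Sum>k<n_space p. c k * lagrange_basis p k x) = 0"
    and k: "k < n_space p"
  shows "c k = 0"
proof -
  have "(\<lambda>x. \<Sum>k<n_space p. c k * lagrange_basis p k x) \<in> poly_space p"
    by (intro poly_space_sum poly_space_scale lagrange_basis) auto
  from poly_space_zero_on_open[OF this W zero]
  have "(\<Sum>l<n_space p. c l * lagrange_basis p l (node p (multi_indices p ! k))) = 0" by simp
  with k show ?thesis
    by (simp add: lagrange_basis if_distrib[of "\<lambda>r. _ * r"] cong: if_cong)
qed

lemma continuous_on_monomial [continuous_intros]:
  "continuous_on S f \<Longrightarrow> continuous_on S (\<lambda>x. monomial \<alpha> (f x))"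
  by (cases \<alpha>) (auto intro!: continuous_intros)

lemma continuous_on_lagrange_basis:
  assumes "k < n_space p" "continuous_on S f"
  shows "continuous_on S (\<lambda>x. lagrange_basis p k (f x))"
proof -
  from lagrange_basis(1)[OF assms(1)]
  obtain c where "lagrange_basis p k = (\<lambda>x. \<Sum>\<alpha>\<in>set (multi_indices p). c \<alpha> * monomial \<alpha> x)"
    by (auto simp: poly_space_def)
  then show ?thesis using assms(2) by (auto intro!: continuous_intros)
qed

section \<open>Mesh geometry\<close>

text \<open>A convex set without interior lies in a hyperplane, but the barycenter and any three of
  the vertices are not coplanar.\<close>

lemma interior_nonempty_tetrahedron:
  assumes "convex S" "v \<in> ref_vertices" "insert ref_barycenter (ref_vertices - {v}) \<subseteq> S"
  shows "interior S \<noteq> {}"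
proof
  assume "interior S = {}"
  with empty_interior_subset_hyperplane assms(1)
  obtain a b where a: "a \<noteq> 0" and "S \<subseteq> {x. a \<bullet> x = b}" by metis
  with assms(3) have eq: "a \<bullet> x = b" if "x \<in> insert ref_barycenter (ref_vertices - {v})" for x
    using that by blast
  have bary: "(a $ 1 + a $ 2 + a $ 3) / 4 = b"
    using eq[of ref_barycenter] by (simp add: ref_barycenter_def inner_vec_def sum_3 add_divide_distrib)
  have "v \<noteq> 0 \<Longrightarrow> b = 0"
    using eq[of 0] by (auto simp: ref_vertices_def)
  moreover have "v \<noteq> axis 1 1 \<Longrightarrow> a $ 1 = b" "v \<noteq> axis 2 1 \<Longrightarrow> a $ 2 = b"
    "v \<noteq> axis 3 1 \<Longrightarrow> a $ 3 = b"
    using eq[of "axis 1 1"] eq[of "axis 2 1"] eq[of "axis 3 1"]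
    by (auto simp: ref_vertices_def inner_axis)
  \<comment> \<open>If the omitted vertex is 0, all components of \<open>a\<close> equal
    \<open>b\<close>, and the barycenter gives \<open>3 * b / 4 = b\<close>. Otherwise
    \<open>b\<close> and two components are 0, and the barycenter removes the third.\<close>
  ultimately have "a $ 1 = 0 \<and> a $ 2 = 0 \<and> a $ 3 = 0"
    using assms(2) bary by (auto simp: ref_vertices_def axis_eq_axis)
  then have "a = 0" by (simp add: Finite_Cartesian_Product.vec_eq_iff forall_3)
  with a show False by simp
qed

lemma convex_ref_tet: "convex ref_tet"
proof -
  have "ref_tet = {x. axis 1 1 \<bullet> x \<ge> 0} \<inter> {x. axis 2 1 \<bullet> x \<ge> 0} \<inter> {x. axis 3 1 \<bullet> x \<ge> 0}
      \<inter> {x. (\<chi> m. 1) \<bullet> x \<le> 1}"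
    by (auto simp: ref_tet_def axis_def inner_vec_def sum_3)
  then show ?thesis
    by (metis convex_Int convex_halfspace_ge convex_halfspace_le)
qed

lemma compact_ref_tet: "compact ref_tet"
proof -
  have "ref_tet \<subseteq> cbox 0 1"
    by (auto simp: ref_tet_def mem_box_cart forall_3)
  moreover have "closed ref_tet"
    unfolding ref_tet_def by (intro closed_Collect_conj closed_Collect_le continuous_intros)
  ultimately show ?thesis
    by (meson bounded_cbox bounded_subset compact_eq_bounded_closed)
qed

lemma ref_vertices_subset: "insert ref_barycenter ref_vertices \<subseteq> ref_tet"
  by (auto simp: ref_vertices_def ref_barycenter_def ref_tet_def axis_def)

section \<open>Compactness and interior points of elements and dual elements\<close>

lemma compact_preimage_chart:
  fixes F :: "'a::euclidean_space \<Rightarrow> 'a"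
  assumes "open U" "continuous_on U F" "inj_on F U" "compact K" "K \<subseteq> F ` U"
  shows "compact {x \<in> U. F x \<in> K}"
proof -
  \<comment> \<open>Invariance of domain supplies a continuous inverse, under which the preimage of
    \<open>K\<close> is the image of a compact set.\<close>
  obtain G where G: "homeomorphism U (F ` U) F G"
    using invariance_of_domain_homeomorphism[OF assms(1,2) order_refl assms(3)] by blast
  then have "{x \<in> U. F x \<in> K} = G ` K"
    using assms(5) by (force simp: homeomorphism_def)
  moreover have "continuous_on K G"
    using G assms(5) by (auto simp: homeomorphism_def intro: continuous_on_subset)
  ultimately show ?thesis
    using assms(4) by (simp add: compact_continuous_image)
qed

lemma C1_on_imp_continuous_on: "C1_on f U \<Longrightarrow> continuous_on U f"
  unfolding C1_on_def
  by (auto intro!: continuous_at_imp_continuous_on differentiable_imp_continuous_within)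

lemmas valid_mesh_elem = valid_mesh_def[THEN iffD1, THEN conjunct1, THEN spec, THEN mp]
lemmas valid_mesh_face = valid_mesh_def[THEN iffD1, THEN conjunct2, THEN spec, THEN mp]

lemma ref_map_image:
  assumes "valid_mesh M" "i < num_elems M"
  shows "ref_map M i ` elem M i = ref_tet"
  using valid_mesh_elem[OF assms, THEN conjunct1] by (rule bij_betw_imp_surj_on)

lemma ref_map_chart:
  assumes "valid_mesh M" "i < num_elems M"
  obtains U where "elem M i \<subseteq> U" "open U" "continuous_on U (ref_map M i)" "inj_on (ref_map M i) U"
proof -
  obtain U where "elem M i \<subseteq> U" "C1_on (ref_map M i) U" "inj_on (ref_map M i) U"
    using valid_mesh_elem[OF assms, THEN conjunct2, THEN conjunct1] by blast
  then show ?thesis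
    using that C1_on_imp_continuous_on by (auto simp: C1_on_def)
qed

lemma continuous_on_ref_map:
  assumes "valid_mesh M" "i < num_elems M"
  shows "continuous_on (elem M i) (ref_map M i)"
  by (rule ref_map_chart[OF assms]) (rule continuous_on_subset)

text \<open>By injectivity on the chart domain \<open>U\<close>, no point of \<open>U\<close>
  outside the element is mapped into \<open>K\<close>. Hence the preimage may be taken in the open
  set \<open>U\<close>, where preimages of open sets are open.\<close>

lemma elem_preimage:
  assumes M: "valid_mesh M" "i < num_elems M" and K: "compact K" "K \<subseteq> ref_tet"
  shows compact_elem_preimage: "compact {x \<in> elem M i. ref_map M i x \<in> K}"
    and interior_elem_preimage:
      "interior K \<subseteq> ref_map M i ` interior {x \<in> elem M i. ref_map M i x \<in> K}"
proof -
  obtain U where U: "elem M i \<subseteq> U" "open U" "continuous_on U (ref_map M i)"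
    "inj_on (ref_map M i) U"
    using ref_map_chart[OF M] by metis
  have im: "K \<subseteq> ref_map M i ` elem M i"
    using K(2) ref_map_image[OF M] by simp
  then have eq: "{x \<in> elem M i. ref_map M i x \<in> K} = {x \<in> U. ref_map M i x \<in> K}"
    using U(1) inj_on_eq_iff[OF U(4)] by (smt (verit) Collect_cong imageE subsetD)
  show "compact {x \<in> elem M i. ref_map M i x \<in> K}"
    unfolding eq using im U by (intro compact_preimage_chart K) auto
  have "open {x \<in> U. ref_map M i x \<in> interior K}"
    using continuous_open_preimage[OF U(3,2) open_interior]
    by (simp add: vimage_def Int_def)
  then have "{x \<in> U. ref_map M i x \<in> interior K} \<subseteq> interior {x \<in> U. ref_map M i x \<in> K}"
    using interior_subset[of K] by (intro interior_maximal) auto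
  moreover have "interior K \<subseteq> ref_map M i ` {x \<in> U. ref_map M i x \<in> interior K}"
    using im interior_subset[of K] U(1) by blast
  ultimately show "interior K \<subseteq> ref_map M i ` interior {x \<in> elem M i. ref_map M i x \<in> K}"
    unfolding eq by blast
qed

lemma elem_eq_preimage:
  assumes "valid_mesh M" "i < num_elems M"
  shows "{x \<in> elem M i. ref_map M i x \<in> ref_tet} = elem M i"
  using ref_map_image[OF assms] by auto

lemma compact_elem:
  assumes "valid_mesh M" "i < num_elems M"
  shows "compact (elem M i)"
  using compact_elem_preimage[OF assms compact_ref_tet] by (simp add: elem_eq_preimage[OF assms])

lemma interior_elem:
  assumes "valid_mesh M" "i < num_elems M"
  shows "interior ref_tet \<subseteq> ref_map M i ` interior (elem M i)"
  using interior_elem_preimage[OF assms compact_ref_tet] by (simp add: elem_eq_preimage[OF assms])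

text \<open>The translated face is the preimage of a reference face, and the reference map sends the
  element onto \<open>ref_tet\<close>, so it maps this preimage onto the whole reference
  face.\<close>

lemma ref_map_at_face:
  assumes M: "valid_mesh M" "i < num_elems M" and j: "j \<in> faces_of M i"
  shows "ref_map_at M i j ` face M j \<in> ref_faces"
proof -
  have "bij_betw (\<lambda>j. (\<lambda>x. x - offset M i j) ` face M j) (faces_of M i) (elem_faces M i)"
    using valid_mesh_elem[OF M] by (elim conjE)
  then have "(\<lambda>x. x - offset M i j) ` face M j \<in> elem_faces M i"
    using j bij_betw_apply by fastforce
  then obtain f where f: "f \<in> ref_faces"
    "(\<lambda>x. x - offset M i j) ` face M j = {x \<in> elem M i. ref_map M i x \<in> f}"
    by (auto simp: elem_faces_def)
  have "f \<subseteq> ref_tet"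
    using f(1) ref_vertices_subset hull_minimal[where S = convex, OF _ convex_ref_tet]
    unfolding ref_faces_def by blast
  then have "ref_map M i ` {x \<in> elem M i. ref_map M i x \<in> f} = f"
    using ref_map_image[OF M] by auto
  then have "ref_map_at M i j ` face M j = f"
    by (simp add: ref_map_at_def[abs_def] image_image flip: f(2))
  with f(1) show ?thesis by simp
qed

text \<open>Up to the translation by \<open>offset\<close>, the set is the preimage of the straight
  tetrahedron \<open>K\<close> over a reference face, which is compact and has interior
  points.\<close>

lemma sub_tet:
  assumes M: "valid_mesh M" "i < num_elems M" and j: "j \<in> faces_of M i"
  shows compact_sub_tet: "compact (sub_tet M i j)"
    and interior_sub_tet: "interior (sub_tet M i j) \<noteq> {}"
proof -
  define K where "K = convex hull (insert ref_barycenter (ref_map_at M i j ` face M j))"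
  obtain v where v: "v \<in> ref_vertices"
    "ref_map_at M i j ` face M j = convex hull (ref_vertices - {v})"
    using ref_map_at_face[OF assms] by (auto simp: ref_faces_def)
  have K: "K = convex hull (insert ref_barycenter (ref_vertices - {v}))"
    unfolding K_def v(2) by (metis hull_insert)
  have "compact K"
    unfolding K by (intro finite_imp_compact_convex_hull) (simp add: ref_vertices_def)
  moreover have "K \<subseteq> ref_tet"
    unfolding K using ref_vertices_subset by (intro hull_minimal convex_ref_tet) auto
  moreover have "interior K \<noteq> {}"
    unfolding K by (intro interior_nonempty_tetrahedron[OF _ v(1)] hull_subset) simp
  ultimately have *: "compact {x \<in> elem M i. ref_map M i x \<in> K}"
    "interior {x \<in> elem M i. ref_map M i x \<in> K} \<noteq> {}"
    using elem_preimage[OF M, of K] by auto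
  have eq: "sub_tet M i j = (\<lambda>x. offset M i j + x) ` {x \<in> elem M i. ref_map M i x \<in> K}"
    by (auto simp: sub_tet_def elem_at_def ref_map_at_def K_def add.commute image_iff)
  show "compact (sub_tet M i j)" "interior (sub_tet M i j) \<noteq> {}"
    unfolding eq using * by (simp_all add: compact_translation interior_translation)
qed

lemma face_elems:
  assumes "valid_mesh M" "j < num_faces M"
  shows "left_elem M j < num_elems M" "right_elem M j < num_elems M" "left_elem M j \<noteq> right_elem M j"
  using valid_mesh_face[OF assms] by simp_all

text \<open>These are the properties that the Gram matrix argument asks of the integration domain;
  the left part already supplies interior points.\<close>

lemma dual_elem:
  assumes M: "valid_mesh M" and j: "j < num_faces M"
  shows compact_dual_elem: "compact (dual_elem M j)"
    and interior_dual_elem: "interior (dual_elem M j) \<noteq> {}"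
proof -
  have "j \<in> faces_of M (left_elem M j)" "j \<in> faces_of M (right_elem M j)"
    using j by (auto simp: faces_of_def)
  note l = sub_tet[OF M face_elems(1)[OF M j] this(1)] and r = sub_tet[OF M face_elems(2)[OF M j] this(2)]
  show "compact (dual_elem M j)"
    unfolding dual_elem_def by (intro compact_Un l(1) r(1))
  have "interior (sub_tet M (left_elem M j) j) \<subseteq> interior (dual_elem M j)"
    unfolding dual_elem_def by (intro interior_mono) auto
  with l(2) show "interior (dual_elem M j) \<noteq> {}" by auto
qed

section \<open>Normals on the faces\<close>

lemma orthogonal_tangents_parallel:
  assumes "n \<bullet> s = 0" "n \<bullet> t = 0" "cross3 s t \<noteq> 0"
  obtains r where "n = r *\<^sub>R cross3 s t"
proof -
  \<comment> \<open>Lagrange's formula expands the double product into multiples of the two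
    vanishing inner products.\<close>
  have "cross3 n (cross3 s t) = 0"
    using assms by (simp add: Lagrange)
  then have "collinear {0, cross3 s t, n}"
    by (simp add: cross_eq_0 insert_commute)
  then show ?thesis
    using assms(3) that by (auto simp: collinear_lemma)
qed

text \<open>Both vectors are multiples of the same nonzero cross product and have the same
  norm.\<close>

lemma unit_normal_at_unique:
  assumes "unit_normal_at M j u n" "unit_normal_at M j u n'"
    and c: "cross3 (tangent M j 1 u) (tangent M j 2 u) \<noteq> 0"
  shows "n = n' \<or> n = - n'"
proof -
  obtain r where r: "n = r *\<^sub>R cross3 (tangent M j 1 u) (tangent M j 2 u)"
    using assms orthogonal_tangents_parallel unfolding unit_normal_at_def by metis
  obtain r' where r': "n' = r' *\<^sub>R cross3 (tangent M j 1 u) (tangent M j 2 u)"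
    using assms orthogonal_tangents_parallel unfolding unit_normal_at_def by metis
  have "\<bar>r\<bar> * norm (cross3 (tangent M j 1 u) (tangent M j 2 u))
      = \<bar>r'\<bar> * norm (cross3 (tangent M j 1 u) (tangent M j 2 u))"
    using assms(1,2) by (simp add: unit_normal_at_def r r')
  with c have "\<bar>r\<bar> = \<bar>r'\<bar>" by simp
  then show ?thesis by (auto simp: r r' abs_eq_iff)
qed

lemma sigma_left: "left_elem M j \<noteq> right_elem M j \<Longrightarrow> sigma M (left_elem M j) j = 1"
  and sigma_right: "left_elem M j \<noteq> right_elem M j \<Longrightarrow> sigma M (right_elem M j) j = - 1"
  by (auto simp: sigma_def field_simps)

text \<open>The two normals agree up to sign. The wrong sign would put the point
  \<open>x + \<epsilon> *\<^sub>R out_normal M i j x\<close> into the element \<open>i\<close> for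
  an \<epsilon> at which both side conditions hold.\<close>

lemma out_normal_eq:
  assumes M: "valid_mesh M" and j: "j \<in> faces_of M i" and u: "u \<in> interior ref_triangle"
  shows "out_normal M i j (face_map M j u) = sigma M i j *\<^sub>R normal M j (face_map M j u)"
proof -
  define x where "x = face_map M j u"
  have jn: "j < num_faces M" and i: "i \<in> {left_elem M j, right_elem M j}"
    using j by (auto simp: faces_of_def)
  have c: "cross3 (tangent M j 1 u) (tangent M j 2 u) \<noteq> 0"
    using valid_mesh_face[OF M jn] u interior_subset by (elim conjE) blast
  have n: "unit_normal_at M j u (normal M j x)"
    "\<forall>\<^sub>F \<epsilon> in at_right 0. x - \<epsilon> *\<^sub>R normal M j x \<in> elem_at M (left_elem M j) j \<and>
       x + \<epsilon> *\<^sub>R normal M j x \<in> elem_at M (right_elem M j) j"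
    using valid_mesh_face[OF M jn] u unfolding Let_def x_def by (elim conjE; blast)+
  have o: "unit_normal_at M j u (out_normal M i j x)"
    "\<forall>\<^sub>F \<epsilon> in at_right 0. x - \<epsilon> *\<^sub>R out_normal M i j x \<in> elem_at M i j \<and>
       x + \<epsilon> *\<^sub>R out_normal M i j x \<notin> elem_at M i j"
    using valid_mesh_face[OF M jn] u i unfolding Let_def x_def by (elim conjE; blast)+
  obtain \<epsilon> where \<epsilon>: "x - \<epsilon> *\<^sub>R normal M j x \<in> elem_at M (left_elem M j) j"
    "x + \<epsilon> *\<^sub>R normal M j x \<in> elem_at M (right_elem M j) j"
    "x + \<epsilon> *\<^sub>R out_normal M i j x \<notin> elem_at M i j"
    using eventually_happens[OF eventually_conj[OF n(2) o(2)]] by auto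
  have lr: "left_elem M j \<noteq> right_elem M j"
    using face_elems[OF M jn] by simp
  from unit_normal_at_unique[OF o(1) n(1) c] i \<epsilon>
  show ?thesis
    by (auto simp: x_def sigma_left[OF lr] sigma_right[OF lr])
qed

section \<open>Mass matrices for degree zero in time\<close>

lemma n_st_tdeg_0: "tdeg P = 0 \<Longrightarrow> n_st P = n_space (sdeg P)"
  by (simp add: n_st_def)

lemma n_st_pos: "0 < n_st P"
  by (simp add: n_st_def n_space_pos)

text \<open>The only temporal index is 0, and the product over the remaining time nodes is
  empty.\<close>

lemma time_factor_tdeg_0:
  assumes "tdeg P = 0" "k < n_st P" shows "time_factor P k t = 1"
proof -
  have "k div n_space (sdeg P) = 0"
    using assms by (simp add: n_st_tdeg_0)
  moreover have "{..0} - {0 :: nat} = {}" by auto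
  ultimately show ?thesis
    by (simp only: time_factor_def assms(1) time_basis_def prod.empty)
qed

lemma phi_tdeg_0:
  "tdeg P = 0 \<Longrightarrow> k < n_st P \<Longrightarrow> phi M P i k x t = lagrange_basis (sdeg P) k (ref_map M i x)"
  by (simp add: phi_def time_factor_tdeg_0) (simp add: n_st_tdeg_0)

lemma psi_tdeg_0:
  "tdeg P = 0 \<Longrightarrow> k < n_st P \<Longrightarrow> psi M P j k x t =
    monomial (multi_indices (sdeg P) ! k) (x - center M j)
      / char_len M j ^ total_deg (multi_indices (sdeg P) ! k)"
  by (simp add: psi_def Let_def time_factor_tdeg_0) (simp add: n_st_tdeg_0)

lemma mass_elem_tdeg_0:
  assumes "tdeg P = 0" "k < n_st P" "l < n_st P"
  shows "mass_elem M P i $$ (k, l) = set_lebesgue_integral lborel (elem M i)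
    (\<lambda>x. lagrange_basis (sdeg P) k (ref_map M i x) * lagrange_basis (sdeg P) l (ref_map M i x))"
proof -
  \<comment> \<open>Written as a constant function of time, so that \<open>deriv\<close> evaluates
    to 0 and the space-time integral disappears.\<close>
  have "phi M P i m x = (\<lambda>t. lagrange_basis (sdeg P) m (ref_map M i x))" if "m < n_st P" for m x
    using phi_tdeg_0[OF assms(1) that] by (intro ext)
  then show ?thesis
    using assms by (simp add: mass_elem_def vol_int_st_def case_prod_beta' set_lebesgue_integral_def)
qed

text \<open>Every interior point of \<open>ref_tet\<close> is the image of an interior point of the
  element, so a combination vanishing inside the element vanishes on an open set of reference
  coordinates.\<close>

lemma mass_elem_pos_def:
  assumes M: "valid_mesh M" "i < num_elems M" and P: "tdeg P = 0"
  shows mass_elem_nonneg: "0 \<le> (\<Sum>k<n_st P. \<Sum>l<n_st P. c k * mass_elem M P i $$ (k, l) * c l)"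
    and mass_elem_pos: "\<exists>k<n_st P. c k \<noteq> 0 \<Longrightarrow>
      0 < (\<Sum>k<n_st P. \<Sum>l<n_st P. c k * mass_elem M P i $$ (k, l) * c l)"
proof -
  have cont: "continuous_on (elem M i) (\<lambda>x. lagrange_basis (sdeg P) k (ref_map M i x))"
    if "k < n_st P" for k
    using that by (intro continuous_on_lagrange_basis continuous_on_ref_map M)
      (simp add: n_st_tdeg_0 P)
  have "open (interior ref_tet)" "interior ref_tet \<noteq> {}"
    using interior_nonempty_tetrahedron[OF convex_ref_tet, of 0] ref_vertices_subset
    by (auto simp: ref_vertices_def)
  note indep = lagrange_basis_independent[OF this]
  have c_0: "c k = 0" if "\<And>x. x \<in> interior (elem M i) \<Longrightarrow>
      (\<Sum>l<n_st P. c l * lagrange_basis (sdeg P) l (ref_map M i x)) = 0" "k < n_st P" for k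
  proof (rule indep[where p = "sdeg P" and c = c and k = k])
    fix y assume "y \<in> interior ref_tet"
    then obtain x where "x \<in> interior (elem M i)" "y = ref_map M i x"
      using interior_elem[OF M] by blast
    then show "(\<Sum>k<n_space (sdeg P). c k * lagrange_basis (sdeg P) k y) = 0"
      using that(1) by (simp add: n_st_tdeg_0 P)
  qed (use that(2) in \<open>simp add: n_st_tdeg_0 P\<close>)
  have eq: "(\<Sum>k<n_st P. \<Sum>l<n_st P. c k * mass_elem M P i $$ (k, l) * c l)
    = (\<Sum>k<n_st P. \<Sum>l<n_st P. c k * set_lebesgue_integral lborel (elem M i)
        (\<lambda>x. lagrange_basis (sdeg P) k (ref_map M i x) * lagrange_basis (sdeg P) l (ref_map M i x)) * c l)"
    by (intro sum.cong refl) (simp add: mass_elem_tdeg_0 P)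
  show "0 \<le> (\<Sum>k<n_st P. \<Sum>l<n_st P. c k * mass_elem M P i $$ (k, l) * c l)"
    unfolding eq by (rule gram_pos_def(1)[OF compact_elem[OF M] cont c_0])
  show "0 < (\<Sum>k<n_st P. \<Sum>l<n_st P. c k * mass_elem M P i $$ (k, l) * c l)"
    if "\<exists>k<n_st P. c k \<noteq> 0"
    unfolding eq by (rule gram_pos_def(2)[OF compact_elem[OF M] cont c_0 that])
qed

section \<open>Mass matrices of the dual elements\<close>

lemma scaled_monomials_independent:
  assumes W: "open W" "W \<noteq> {}" and h: "0 < h"
    and zero: "\<And>x. x \<in> W \<Longrightarrow> (\<Sum>k<n_space p. c k * (monomial (multi_indices p ! k) (x - x0)
      / h ^ total_deg (multi_indices p ! k))) = 0"
    and k: "k < n_space p"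
  shows "c k = 0"
proof -
  \<comment> \<open>Inverse of the enumeration; it turns coefficients numbered by \<open>k\<close>
    into coefficients indexed by multi-indices, with the scaling absorbed in
    \<open>d\<close>.\<close>
  define ind where "ind = the_inv_into {..<n_space p} ((!) (multi_indices p))"
  have ind: "ind (multi_indices p ! l) = l" if "l < n_space p" for l
    using that bij_betw_multi_indices[of p] unfolding ind_def bij_betw_def
    by (intro the_inv_into_f_f) auto
  define d where "d \<alpha> = c (ind \<alpha>) / h ^ total_deg \<alpha>" for \<alpha>
  have "open ((\<lambda>x. x - x0) ` W)" "(\<lambda>x. x - x0) ` W \<noteq> {}"
    using W open_translation[of W "- x0"] by auto
  moreover have "(\<Sum>\<alpha>\<in>set (multi_indices p). d \<alpha> * monomial \<alpha> y) = 0" if y: "y \<in> (\<lambda>x. x - x0) ` W" for y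
  proof -
    have "(\<Sum>\<alpha>\<in>set (multi_indices p). d \<alpha> * monomial \<alpha> y)
      = (\<Sum>k<n_space p. d (multi_indices p ! k) * monomial (multi_indices p ! k) y)"
      by (rule sum.reindex_bij_betw[OF bij_betw_multi_indices, symmetric])
    also have "\<dots> = (\<Sum>k<n_space p. c k * (monomial (multi_indices p ! k) y
        / h ^ total_deg (multi_indices p ! k)))"
      by (intro sum.cong refl) (simp add: d_def ind)
    also have "\<dots> = 0" using y zero by auto
    finally show ?thesis .
  qed
  moreover have "multi_indices p ! k \<in> set (multi_indices p)"
    using k by (simp add: length_multi_indices)
  ultimately have "d (multi_indices p ! k) = 0"
    by (rule monomials_independent)
  then show ?thesis
    using h k by (simp add: d_def ind)
qed

lemma mass_dual_pos:
  assumes M: "valid_mesh M" "j < num_faces M" and P: "tdeg P = 0" "t_old P < t_new P"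
    and c: "\<exists>k<n_st P. c k \<noteq> 0"
  shows "0 < (\<Sum>k<n_st P. \<Sum>l<n_st P. c k * mass_dual M P j $$ (k, l) * c l)"
proof -
  define g where "g k z = psi M P j k (fst z) (snd z)" for k z
  have g: "g k = (\<lambda>z. monomial (multi_indices (sdeg P) ! k) (fst z - center M j)
      / char_len M j ^ total_deg (multi_indices (sdeg P) ! k))" if "k < n_st P" for k
    using that by (simp add: g_def psi_tdeg_0 P fun_eq_iff)
  have h: "0 < char_len M j"
    using valid_mesh_face[OF M] by simp
  let ?A = "dual_elem M j \<times> t_int P"
  have A: "compact ?A"
    by (simp add: compact_Times compact_dual_elem[OF M] t_int_def)
  have int: "interior ?A = interior (dual_elem M j) \<times> {t_old P<..<t_new P}"
    by (simp add: interior_Times t_int_def)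
  have cont: "continuous_on ?A (g k)" if "k < n_st P" for k
    unfolding g[OF that] using h by (intro continuous_intros) auto
  have indep: "c k = 0" if zero: "\<And>z. z \<in> interior ?A \<Longrightarrow> (\<Sum>l<n_st P. c l * g l z) = 0"
    and k: "k < n_st P" for k
  proof (rule scaled_monomials_independent[OF open_interior interior_dual_elem[OF M] h,
        where p = "sdeg P" and k = k and c = c and ?x0.0 = "center M j"])
    fix x assume "x \<in> interior (dual_elem M j)"
    \<comment> \<open>The midpoint serves as an interior time; the basis functions have the same
      value at all times.\<close>
    then have "(x, (t_old P + t_new P) / 2) \<in> interior ?A"
      unfolding int using P(2) by simp
    from zero[OF this] show "(\<Sum>k<n_space (sdeg P). c k * (monomial (multi_indices (sdeg P) ! k)
        (x - center M j) / char_len M j ^ total_deg (multi_indices (sdeg P) ! k))) = 0"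
      by (simp add: g n_st_tdeg_0 P)
  qed (use k in \<open>simp add: n_st_tdeg_0 P\<close>)
  have "mass_dual M P j $$ (k, l) = set_lebesgue_integral lborel ?A (\<lambda>z. g k z * g l z)"
    if "k < n_st P" "l < n_st P" for k l
    using that by (simp add: mass_dual_def vol_int_st_def case_prod_beta' g_def)
  then have eq: "(\<Sum>k<n_st P. \<Sum>l<n_st P. c k * mass_dual M P j $$ (k, l) * c l)
    = (\<Sum>k<n_st P. \<Sum>l<n_st P. c k * set_lebesgue_integral lborel ?A (\<lambda>z. g k z * g l z) * c l)"
    by (intro sum.cong refl) simp
  show ?thesis
    unfolding eq by (rule gram_pos_def(2)[OF A cont indep c])
qed

text \<open>The inner product of \<open>w a\<close> and \<open>w b\<close> splits into three
  components, and the scalar result applies to each of them.\<close>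

lemma mass_dual_inverse_nonneg:
  fixes w :: "nat \<Rightarrow> real^3"
  assumes M: "valid_mesh M" "j < num_faces M" and P: "tdeg P = 0" "t_old P < t_new P"
  shows "0 \<le> (\<Sum>a<n_st P. \<Sum>b<n_st P. the (mat_inverse (mass_dual M P j)) $$ (a, b) * (w a \<bullet> w b))"
proof -
  have A: "mass_dual M P j \<in> carrier_mat (n_st P) (n_st P)"
    by (simp add: mass_dual_def)
  have "0 < scalar_prod x (mass_dual M P j *\<^sub>v x)"
    if x: "x \<in> carrier_vec (n_st P)" "x \<noteq> 0\<^sub>v (n_st P)" for x
  proof -
    have "\<exists>k<n_st P. vec_index x k \<noteq> 0"
      using x by (auto simp: Matrix.vec_eq_iff)
    from mass_dual_pos[OF M P this] show ?thesis
      by (simp add: mat_quadratic_form[OF A x(1)])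
  qed
  then have "0 \<le> (\<Sum>a<n_st P. \<Sum>b<n_st P. the (mat_inverse (mass_dual M P j)) $$ (a, b) * (y a * y b))"
    for y by (rule pos_def_mat_inverse[OF A])
  then have "0 \<le> (\<Sum>m\<in>UNIV. \<Sum>a<n_st P. \<Sum>b<n_st P.
      the (mat_inverse (mass_dual M P j)) $$ (a, b) * (w a $ m * w b $ m))"
    by (rule sum_nonneg)
  also have "\<dots> = (\<Sum>a<n_st P. \<Sum>b<n_st P. \<Sum>m\<in>UNIV.
      the (mat_inverse (mass_dual M P j)) $$ (a, b) * (w a $ m * w b $ m))"
    by (subst sum.swap, rule sum.cong[OF refl], rule sum.swap)
  finally show ?thesis
    by (simp add: inner_vec_def sum_distrib_left)
qed

section \<open>Quadratic form of the viscous system\<close>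

lemma surf_int_st_cong:
  assumes "\<And>u t. u \<in> interior ref_triangle \<Longrightarrow> f (face_map M j u) t = g (face_map M j u) t"
  shows "surf_int_st M P j f = surf_int_st M P j g"
  \<comment> \<open>The integral runs over interior parameters only, which are the ones where the
    mesh prescribes the directions of the normals.\<close>
  unfolding surf_int_st_def set_lebesgue_integral_def
  by (rule Bochner_Integration.integral_cong) (auto simp: indicator_def assms)

text \<open>The integrals are of the same function up to sign, so that no integrability is needed.\<close>

lemma D_mat_eq_Q_mat:
  assumes M: "valid_mesh M" and j: "j \<in> faces_of M i" and "k < n_st P" "l < n_st P"
  shows "D_mat M P i j $$ (k, l) = - Q_mat M P i j $$ (l, k)"
proof -
  \<comment> \<open>The volume integrals of both entries coincide as they stand; the surface
    integrals agree by the identity of the normals.\<close>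
  have "surf_int_st M P j (\<lambda>x t. (phi_at M P i j k x t * psi M P j l x t) *\<^sub>R out_normal M i j x)
    = surf_int_st M P j (\<lambda>x t. (psi M P j l x t * phi_at M P i j k x t)
        *\<^sub>R (sigma M i j *\<^sub>R normal M j x))"
    by (intro surf_int_st_cong) (simp add: out_normal_eq[OF M j] mult.commute)
  then show ?thesis
    using assms by (simp add: D_mat_def Q_mat_def)
qed

text \<open>Replacing \<open>D\<close> by the negative transpose of \<open>Q\<close> moves
  \<open>x\<close> onto \<open>Q\<close>, leaving minus the bilinear form of the inverse dual mass
  matrix.\<close>

lemma DMQ_quadratic_form:
  assumes M: "valid_mesh M" and j: "j \<in> faces_of M i"
  shows "(\<Sum>k<n_st P. \<Sum>l<n_st P. x k * DMQ M P i i' j $$ (k, l) * y l)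
    = - (\<Sum>a<n_st P. \<Sum>b<n_st P. the (mat_inverse (mass_dual M P j)) $$ (a, b) *
        ((\<Sum>k<n_st P. x k *\<^sub>R Q_mat M P i j $$ (a, k)) \<bullet> (\<Sum>l<n_st P. y l *\<^sub>R Q_mat M P i' j $$ (b, l))))"
proof -
  let ?n = "n_st P" and ?B = "the (mat_inverse (mass_dual M P j))"
    and ?Q = "Q_mat M P i j" and ?Q' = "Q_mat M P i' j"
  have "(\<Sum>k<?n. \<Sum>l<?n. x k * DMQ M P i i' j $$ (k, l) * y l)
    = - (\<Sum>k<?n. \<Sum>l<?n. \<Sum>a<?n. \<Sum>b<?n. ?B $$ (a, b) * ((x k *\<^sub>R ?Q $$ (a, k)) \<bullet> (y l *\<^sub>R ?Q' $$ (b, l))))"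
    by (simp add: DMQ_def D_mat_eq_Q_mat[OF M j] sum_distrib_left sum_distrib_right sum_negf
        flip: sum_negf) (simp add: ac_simps)
  \<comment> \<open>The four sums are flattened into one sum over quadruples, whose entries are then
    permuted.\<close>
  also have "(\<Sum>k<?n. \<Sum>l<?n. \<Sum>a<?n. \<Sum>b<?n. ?B $$ (a, b) * ((x k *\<^sub>R ?Q $$ (a, k)) \<bullet> (y l *\<^sub>R ?Q' $$ (b, l))))
    = (\<Sum>a<?n. \<Sum>b<?n. \<Sum>k<?n. \<Sum>l<?n. ?B $$ (a, b) * ((x k *\<^sub>R ?Q $$ (a, k)) \<bullet> (y l *\<^sub>R ?Q' $$ (b, l))))"
    by (simp add: sum.cartesian_product) (rule sum.reindex_bij_witness[of _
          "\<lambda>(a, b, k, l). (k, l, a, b)" "\<lambda>(k, l, a, b). (a, b, k, l)"], auto)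
  finally show ?thesis
    by (simp only: inner_sum_left) (simp only: inner_sum_right sum_distrib_left)
qed

section \<open>Assembly of element and face terms\<close>

lemma finite_faces_of: "finite (faces_of M i)"
  by (simp add: faces_of_def)

text \<open>Double counting of incident pairs: every face belongs to exactly two distinct
  elements.\<close>

lemma sum_elem_faces:
  fixes f :: "nat \<Rightarrow> nat \<Rightarrow> 'a::comm_monoid_add"
  assumes "valid_mesh M"
  shows "(\<Sum>i<num_elems M. \<Sum>j\<in>faces_of M i. f i j)
    = (\<Sum>j<num_faces M. f (left_elem M j) j + f (right_elem M j) j)"
proof -
  have "(\<Sum>i<num_elems M. \<Sum>j\<in>faces_of M i. f i j)
    = (\<Sum>i<num_elems M. \<Sum>j | j \<in> {..<num_faces M} \<and> i \<in> {left_elem M j, right_elem M j}. f i j)"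
    by (intro sum.cong refl) (auto simp: faces_of_def)
  also have "\<dots> = (\<Sum>j<num_faces M. \<Sum>i | i \<in> {..<num_elems M} \<and> i \<in> {left_elem M j, right_elem M j}. f i j)"
    by (rule sum.swap_restrict) auto
  also have "\<dots> = (\<Sum>j<num_faces M. f (left_elem M j) j + f (right_elem M j) j)"
  proof (intro sum.cong refl)
    fix j assume "j \<in> {..<num_faces M}"
    then have j: "j < num_faces M" by simp
    have "{i. i \<in> {..<num_elems M} \<and> i \<in> {left_elem M j, right_elem M j}} = {left_elem M j, right_elem M j}"
      using face_elems[OF assms j] by auto
    then show "(\<Sum>i | i \<in> {..<num_elems M} \<and> i \<in> {left_elem M j, right_elem M j}. f i j)
      = f (left_elem M j) j + f (right_elem M j) j"
      using face_elems(3)[OF assms j] by simp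
  qed
  finally show ?thesis .
qed

text \<open>Grouping the faces of \<open>i\<close> by their neighbour and then summing over all
  \<open>i'\<close> visits each face once, even if several faces lead to the same neighbour.\<close>

lemma viscous_block_row:
  assumes M: "valid_mesh M" and i: "i < num_elems M"
  shows "(\<Sum>i'<num_elems M. \<Sum>l<n. viscous_block M P \<nu> i i' k l * X i' l)
    = (\<Sum>l<n. mass_elem M P i $$ (k, l) * X i l)
      - \<nu> * (\<Sum>j\<in>faces_of M i. (\<Sum>l<n. DMQ M P i i j $$ (k, l) * X i l)
          + (\<Sum>l<n. DMQ M P i (neighbour M i j) j $$ (k, l) * X (neighbour M i j) l))"
proof -
  let ?S = "faces_of M i" and ?nb = "neighbour M i"
  let ?d = "\<lambda>l. mass_elem M P i $$ (k, l) - \<nu> * (\<Sum>j\<in>?S. DMQ M P i i j $$ (k, l))"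
  let ?e = "\<lambda>j l. DMQ M P i (?nb j) j $$ (k, l)"
  have nb: "?nb ` ?S \<subseteq> {..<num_elems M}"
    using face_elems[OF M] by (auto simp: faces_of_def neighbour_def)
  have "(\<Sum>i'<num_elems M. \<Sum>l<n. viscous_block M P \<nu> i i' k l * X i' l)
    = (\<Sum>i'<num_elems M. (if i' = i then \<Sum>l<n. ?d l * X i l else 0)
        - \<nu> * (\<Sum>j | j \<in> ?S \<and> ?nb j = i'. \<Sum>l<n. ?e j l * X (?nb j) l))"
  proof (intro sum.cong refl)
    fix i'
    have "(\<Sum>j | j \<in> ?S \<and> ?nb j = i'. \<Sum>l<n. ?e j l * X (?nb j) l)
      = (\<Sum>l<n. (\<Sum>j | j \<in> ?S \<and> ?nb j = i'. ?e j l) * X i' l)"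
      unfolding sum_distrib_right by (subst sum.swap) (intro sum.cong refl, simp)
    then show "(\<Sum>l<n. viscous_block M P \<nu> i i' k l * X i' l)
      = (if i' = i then \<Sum>l<n. ?d l * X i l else 0)
        - \<nu> * (\<Sum>j | j \<in> ?S \<and> ?nb j = i'. \<Sum>l<n. ?e j l * X (?nb j) l)"
      by (auto simp: viscous_block_def left_diff_distrib sum_subtractf mult.assoc
          simp flip: sum_distrib_left)
  qed
  also have "\<dots> = (\<Sum>l<n. ?d l * X i l) - \<nu> * (\<Sum>j\<in>?S. \<Sum>l<n. ?e j l * X (?nb j) l)"
    unfolding sum_subtractf sum_distrib_left[symmetric] sum.group[OF finite_faces_of finite_lessThan nb]
    using i by simp
  also have "(\<Sum>l<n. ?d l * X i l) = (\<Sum>l<n. mass_elem M P i $$ (k, l) * X i l)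
      - \<nu> * (\<Sum>j\<in>?S. \<Sum>l<n. DMQ M P i i j $$ (k, l) * X i l)"
    by (subst sum.swap) (simp add: left_diff_distrib sum_subtractf sum_distrib_left
        sum_distrib_right mult.assoc)
  finally show ?thesis
    by (simp add: sum.distrib algebra_simps)
qed

text \<open>By bilinearity the four terms merge into minus the form of the inverse dual mass matrix
  at \<open>W L + W R\<close>.\<close>

lemma DMQ_face_nonpos:
  fixes X :: "nat \<Rightarrow> nat \<Rightarrow> real"
  assumes M: "valid_mesh M" "j < num_faces M" and P: "tdeg P = 0" "t_old P < t_new P"
  defines "T \<equiv> \<lambda>i i'. \<Sum>k<n_st P. \<Sum>l<n_st P. X i k * DMQ M P i i' j $$ (k, l) * X i' l"
    and "L \<equiv> left_elem M j" and "R \<equiv> right_elem M j"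
  shows "(T L L + T L R) + (T R R + T R L) \<le> 0"
proof -
  let ?B = "the (mat_inverse (mass_dual M P j))"
  define W where "W i a = (\<Sum>k<n_st P. X i k *\<^sub>R Q_mat M P i j $$ (a, k))" for i a
  have j: "j \<in> faces_of M L" "j \<in> faces_of M R"
    using M by (auto simp: faces_of_def L_def R_def)
  have T: "T i i' = - (\<Sum>a<n_st P. \<Sum>b<n_st P. ?B $$ (a, b) * (W i a \<bullet> W i' b))"
    if "j \<in> faces_of M i" for i i'
    unfolding T_def W_def by (rule DMQ_quadratic_form[OF M(1) that])
  have "(T L L + T L R) + (T R R + T R L)
    = - (\<Sum>a<n_st P. \<Sum>b<n_st P. ?B $$ (a, b) * ((W L a + W R a) \<bullet> (W L b + W R b)))"
    by (simp add: T j inner_add_left inner_add_right distrib_left sum.distrib)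
  also have "\<dots> \<le> 0"
    using mass_dual_inverse_nonneg[OF M P, of "\<lambda>a. W L a + W R a"] by simp
  finally show ?thesis .
qed

text \<open>Block rows are evaluated element by element, and the viscous terms are then regrouped by
  faces, which brings together the four terms of each square.\<close>

lemma viscous_matrix_quadratic_form:
  assumes M: "valid_mesh M" and x: "x \<in> carrier_vec (num_elems M * n_st P)"
  defines "X \<equiv> \<lambda>i k. vec_index x (i * n_st P + k)"
  defines "T \<equiv> \<lambda>j i i'. \<Sum>k<n_st P. \<Sum>l<n_st P. X i k * DMQ M P i i' j $$ (k, l) * X i' l"
  shows "scalar_prod x (viscous_matrix M P \<nu> *\<^sub>v x)
    = (\<Sum>i<num_elems M. \<Sum>k<n_st P. \<Sum>l<n_st P. X i k * mass_elem M P i $$ (k, l) * X i l)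
      - \<nu> * (\<Sum>j<num_faces M.
          (T j (left_elem M j) (left_elem M j) + T j (left_elem M j) (right_elem M j))
        + (T j (right_elem M j) (right_elem M j) + T j (right_elem M j) (left_elem M j)))"
proof -
  let ?n = "n_st P" and ?N = "num_elems M"
  have idx: "i * ?n + k < ?N * ?n" if "i < ?N" "k < ?n" for i k
  proof -
    have "i * ?n + k < Suc i * ?n" using that by simp
    also have "\<dots> \<le> ?N * ?n" using that by (intro mult_le_mono1) simp
    finally show ?thesis .
  qed
  have S: "viscous_matrix M P \<nu> \<in> carrier_mat (?N * ?n) (?N * ?n)"
    by (simp add: viscous_matrix_def)
  have "scalar_prod x (viscous_matrix M P \<nu> *\<^sub>v x)
    = (\<Sum>i<?N. \<Sum>k<?n. \<Sum>i'<?N. \<Sum>l<?n. X i k * viscous_block M P \<nu> i i' k l * X i' l)"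
    unfolding mat_quadratic_form[OF S x] sum_mult_nat_group X_def
    by (intro sum.cong refl) (simp add: viscous_matrix_def idx n_st_pos)
  also have "\<dots> = (\<Sum>i<?N. \<Sum>k<?n. X i k * (\<Sum>i'<?N. \<Sum>l<?n. viscous_block M P \<nu> i i' k l * X i' l))"
    by (simp add: sum_distrib_left mult.assoc)
  also have "\<dots> = (\<Sum>i<?N. (\<Sum>k<?n. \<Sum>l<?n. X i k * mass_elem M P i $$ (k, l) * X i l)
      - \<nu> * (\<Sum>j\<in>faces_of M i. T j i i + T j i (neighbour M i j)))"
  proof (intro sum.cong refl)
    fix i assume "i \<in> {..<?N}"
    then have i: "i < ?N" by simp
    have "(\<Sum>k<?n. X i k * (\<Sum>j\<in>faces_of M i. (\<Sum>l<?n. DMQ M P i i j $$ (k, l) * X i l)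
          + (\<Sum>l<?n. DMQ M P i (neighbour M i j) j $$ (k, l) * X (neighbour M i j) l)))
      = (\<Sum>j\<in>faces_of M i. T j i i + T j i (neighbour M i j))"
      unfolding T_def sum_distrib_left
      by (subst sum.swap) (simp add: distrib_left sum.distrib sum_distrib_left mult.assoc)
    then show "(\<Sum>k<?n. X i k * (\<Sum>i'<?N. \<Sum>l<?n. viscous_block M P \<nu> i i' k l * X i' l))
      = (\<Sum>k<?n. \<Sum>l<?n. X i k * mass_elem M P i $$ (k, l) * X i l)
        - \<nu> * (\<Sum>j\<in>faces_of M i. T j i i + T j i (neighbour M i j))"
      by (simp add: viscous_block_row[OF M i] right_diff_distrib sum_subtractf mult.left_commute[of _ \<nu>]
          flip: sum_distrib_left) (simp add: sum_distrib_left mult.assoc)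
  qed
  also have "\<dots> = (\<Sum>i<?N. \<Sum>k<?n. \<Sum>l<?n. X i k * mass_elem M P i $$ (k, l) * X i l)
      - \<nu> * (\<Sum>i<?N. \<Sum>j\<in>faces_of M i. T j i i + T j i (neighbour M i j))"
    by (simp add: sum_subtractf sum_distrib_left)
  \<comment> \<open>The two elements of a face are distinct, so \<open>neighbour\<close> exchanges
    them.\<close>
  also have "(\<Sum>i<?N. \<Sum>j\<in>faces_of M i. T j i i + T j i (neighbour M i j))
    = (\<Sum>j<num_faces M.
          (T j (left_elem M j) (left_elem M j) + T j (left_elem M j) (right_elem M j))
        + (T j (right_elem M j) (right_elem M j) + T j (right_elem M j) (left_elem M j)))"
    unfolding sum_elem_faces[OF M]
    by (intro sum.cong refl) (use face_elems(3)[OF M] in \<open>auto simp: neighbour_def\<close>)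
  finally show ?thesis .
qed

theorem corollary4:
  fixes M :: dg_mesh and P :: dg_params and \<nu> :: real
  assumes "valid_mesh M"
    and "t_old P < t_new P"
    and "0 < \<nu>"
    and "tdeg P = 0"
  shows "viscous_matrix M P \<nu>
           \<in> carrier_mat (num_elems M * n_space (sdeg P)) (num_elems M * n_space (sdeg P)) \<and>
         (\<forall>x \<in> carrier_vec (num_elems M * n_space (sdeg P)).
            x \<noteq> 0\<^sub>v (num_elems M * n_space (sdeg P)) \<longrightarrow>
            0 < scalar_prod x (viscous_matrix M P \<nu> *\<^sub>v x))"
  unfolding n_st_tdeg_0[OF assms(4), symmetric]
proof (intro conjI ballI impI)
  let ?n = "n_st P" and ?N = "num_elems M"
  show "viscous_matrix M P \<nu> \<in> carrier_mat (?N * ?n) (?N * ?n)"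
    by (simp add: viscous_matrix_def)
  fix x :: "real Matrix.vec"
  assume x: "x \<in> carrier_vec (?N * ?n)" "x \<noteq> 0\<^sub>v (?N * ?n)"
  define X where "X i k = vec_index x (i * ?n + k)" for i k
  define T where "T j i i' = (\<Sum>k<?n. \<Sum>l<?n. X i k * DMQ M P i i' j $$ (k, l) * X i' l)" for j i i'
  \<comment> \<open>The element \<open>r div ?n\<close> containing this nonzero entry makes its mass
    term strictly positive, while the other mass terms are nonnegative.\<close>
  obtain r where r: "r < ?N * ?n" "vec_index x r \<noteq> 0"
    using x by (auto simp: Matrix.vec_eq_iff)
  have "r div ?n < ?N" "r mod ?n < ?n" "X (r div ?n) (r mod ?n) \<noteq> 0"
    using r n_st_pos[of P] by (auto simp: X_def less_mult_imp_div_less)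
  then have "0 < (\<Sum>i<?N. \<Sum>k<?n. \<Sum>l<?n. X i k * mass_elem M P i $$ (k, l) * X i l)"
    by (intro sum_pos2[of _ "r div ?n"] mass_elem_pos mass_elem_nonneg assms) auto
  moreover have "(\<Sum>j<num_faces M.
      (T j (left_elem M j) (left_elem M j) + T j (left_elem M j) (right_elem M j))
    + (T j (right_elem M j) (right_elem M j) + T j (right_elem M j) (left_elem M j))) \<le> 0"
    unfolding T_def by (intro sum_nonpos DMQ_face_nonpos assms) auto
  then have "\<nu> * (\<Sum>j<num_faces M.
      (T j (left_elem M j) (left_elem M j) + T j (left_elem M j) (right_elem M j))
    + (T j (right_elem M j) (right_elem M j) + T j (right_elem M j) (left_elem M j))) \<le> 0"
    using assms(3) by (simp add: mult_le_0_iff)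
  ultimately show "0 < scalar_prod x (viscous_matrix M P \<nu> *\<^sub>v x)"
    unfolding viscous_matrix_quadratic_form[OF assms(1) x(1)] X_def[symmetric] T_def[symmetric]
    by linarith
qed

end
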